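(* Let $p,q\in[1,\infty]$, let $\beta:\mathbb{R}^e\times\mathbb{R}^f\to\mathbb{R}^g$ be a bilinear map given by a representation $[L;R;P]$ with $L\in\mathbb{R}^{r\times e}$, $R\in\mathbb{R}^{r\times f}$, $P\in\mathbb{R}^{g\times r}$, let $\beta^{(0)}:\mathbb{R}^{e_0}\times\mathbb{R}^{f_0}\to\mathbb{R}^{g_0}$ be a bilinear base case with error factor $f^{(0)}_{p,q}$, and let $\ell\ge 0$. Then the forward error in computing $\beta^{\otimes^\ell}$ in floating point arithmetic with machine precision $\varepsilon$ satisfies, for all $u\in\mathbb{R}^{e_0e^\ell}$ and $v\in\mathbb{R}^{f_0f^\ell}$, $$\left\|\widehat{\beta^{\otimes^\ell}(u,v)}-\beta^{\otimes^\ell}(u,v)\right\|_p\le f^{(\ell)}_{p,q}\,\|u\|_q\|v\|_q\,\varepsilon+O(\varepsilon^2),$$ where $$f^{(\ell)}_{p,q}=\gamma_{p,q}^{\ell}\left(f^{(0)}_{p,q}+Q_0\,\Gamma^{(0)}_{p,q}\sum_{i=0}^{\ell-1}\left(\frac{\Gamma_{p,q}}{\gamma_{p,q}}\right)^{i}\right)$$ and $$Q_0=\max_j\Bigl(\|P_{j,*}\|_0+\max_i\bigl(\|L_{i,*}\|_0+\|R_{i,*}\|_0\bigr)\mathbb{1}_{p_{j,i}\ne0}\Bigr).$$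
   Context: **Norms.** $\|\cdot\|_p$, $\|\cdot\|_q$ are the usual $\ell_p$, $\ell_q$ norms of real vectors; $\|\cdot\|_{q^\star}$ is the dual norm of $\|\cdot\|_q$ ($1/q+1/q^\star=1$). $\|x\|_0$ is the number of nonzero entries of $x$. $A_{i,*}$ is the $i$-th row and $A_{*,i}$ the $i$-th column of $A$. Matrices are measured through their vectorizations. **Representation.** $[L;R;P]$ represents $\beta$ means $\beta(u,v)=\sum_{i=1}^r P_{*,i}\,(L_{i,*}\cdot u)(R_{i,*}\cdot v)$. **Recursion.** $\beta^{\otimes^0}=\beta^{(0)}$, and for $\ell\ge1$, $\beta^{\otimes^\ell}:\mathbb{R}^{e_0e^\ell}\times\mathbb{R}^{f_0f^\ell}\to\mathbb{R}^{g_0g^\ell}$ is $$\beta^{\otimes^\ell}(u,v)=\sum_{i=1}^rP_{*,i}\,\beta^{\otimes^{\ell-1}}(L_{i,*}\cdot u,\,R_{i,*}\cdot v).$$ Here $u$ is cut into $e$ contiguous blocks $u_1,\dots,u_e$ of length $e_0e^{\ell-1}$ and $L_{i,*}\cdot u=\sum_j l_{i,j}u_j$; similarly $R_{i,*}\cdot v=\sum_j r_{i,j}v_j$ with $f$ blocks of length $f_0f^{\ell-1}$. The $J$-th contiguous block of length $g_0g^{\ell-1}$ of the output is $\sum_i p_{J,i}\beta^{\otimes^{\ell-1}}(L_{i,*}\cdot u,R_{i,*}\cdot v)$. **Growth factor.** $\gamma_{p,q}=\bigl\|\bigl(\sum_{i=1}^r\|L_{i,*}\|_{q^\star}\|R_{i,*}\|_{q^\star}|p_{j,i}|\bigr)_{j}\bigr\|_p$,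 assumed nonzero. **Amplification factors $\Gamma_{p,q},\Gamma^{(0)}_{p,q}$.** - If $\beta$ encodes the $m\times k$ by $k\times n$ matrix multiplication ($e=mk$, $f=kn$, $g=mn$) with base case an $m_0\times k_0$ by $k_0\times n_0$ matrix multiplication (matrices stored in the block-recursive order, so that $\beta^{\otimes^\ell}$ encodes multiplication of $m_0m^\ell\times k_0k^\ell$ by $k_0k^\ell\times n_0n^\ell$ matrices), then $(\Gamma^{(0)}_{\infty,\infty},\Gamma_{\infty,\infty})=(k_0,k)$, $(\Gamma^{(0)}_{2,2},\Gamma_{2,2})=(1,1)$, $(\Gamma^{(0)}_{\infty,2},\Gamma_{\infty,2})=(1,1)$, $(\Gamma^{(0)}_{2,\infty},\Gamma_{2,\infty})=(k_0^{3/2},k^{3/2})$. - Otherwise $(\Gamma^{(0)}_{p,q},\Gamma_{p,q})=(\gamma^{(0)}_{p,q},\gamma_{p,q})$, where $\gamma^{(0)}_{p,q}$ is such that $\|\beta^{(0)}(u,v)\|_p\le\gamma^{(0)}_{p,q}\|u\|_q\|v\|_q$ for all $u,v$. **Floating point model.** A hat denotes a computed value. Every operation $\mathrm{op}\in\{+,-,\times,/\}$ returns $(a\,\mathrm{op}\,b)(1+\delta)$ with $|\delta|\le\varepsilon$. The linear combinations with coefficients given by rows of $L$, $R$, $P$ are computed coordinatewise as scalar products over the nonzero coefficients, in any order of summation, following the recursion above. $O(\varepsilon^2)$ is for $\varepsilon\to0$, all other data being fixed (with constants uniform for inputs in bounded sets). **Base case error.** $f^{(0)}_{p,q}$ is a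 constant such that the floating point algorithm used for $\beta^{(0)}$ satisfies $\|\widehat{\beta^{(0)}}(u,v)-\beta^{(0)}(u,v)\|_p\le f^{(0)}_{p,q}\|u\|_q\|v\|_q\varepsilon+O(\varepsilon^2)$.
   Formalization: For matrix multiplication with (p,q)=(2,∞), the stated amplification factors k_0^{3/2}, k^{3/2} make the claim false; they are replaced by max(k_0^{3/2}, k_0√(m_0n_0)) and max(k^{3/2}, k√(mn)), which agree with the originals when m_0n_0≤k_0 and mn≤k. *)

theory Defs
  imports
    Complex_Main
    "HOL-Library.Multiset"
    "HOL-Library.Extended_Real"
    "Jordan_Normal_Form.Matrix"
begin

section \<open>Norms\<close>

definition lp_norm :: "ereal \<Rightarrow> real vec \<Rightarrow> real" where
  "lp_norm p x =
     (if p = \<infinity> then Max (insert 0 ((\<lambda>i. \<bar>x $ i\<bar>) ` {..<dim_vec x}))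
      else (\<Sum>i<dim_vec x. \<bar>x $ i\<bar> powr real_of_ereal p) powr (1 / real_of_ereal p))"

definition conj_exponent :: "ereal \<Rightarrow> ereal" where
  "conj_exponent q = 1 / (1 - 1 / q)"

text \<open>The two extreme cases rely on \<open>1 / 0 = \<infinity>\<close> and \<open>1 / \<infinity> = 0\<close> in \<^typ>\<open>ereal\<close>.\<close>

lemma conj_exponent:
  assumes "1 \<le> q"
  shows "1 / q + 1 / conj_exponent q = 1" and "1 \<le> conj_exponent q"
proof -
  consider "q = 1" | "q = \<infinity>" | x where "q = ereal x" "x > 1"
    using assms by (cases q) (force simp: one_ereal_def)+
  then have "1 / q + 1 / conj_exponent q = 1 \<and> 1 \<le> conj_exponent q"
  proof cases
    case 3
    then have "conj_exponent q = ereal (1 / (1 - 1 / x))"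
      by (auto simp: conj_exponent_def one_ereal_def)
    with 3 show ?thesis
      by (auto simp: one_ereal_def field_simps)
  qed (auto simp: conj_exponent_def one_ereal_def zero_ereal_def)
  then show "1 / q + 1 / conj_exponent q = 1" and "1 \<le> conj_exponent q" by auto
qed

definition nnz :: "real vec \<Rightarrow> nat" where
  "nnz x = card {i. i < dim_vec x \<and> x $ i \<noteq> 0}"

section \<open>Bilinear maps and the recursion\<close>

definition bilinear_map ::
    "nat \<Rightarrow> nat \<Rightarrow> nat \<Rightarrow> (real vec \<Rightarrow> real vec \<Rightarrow> real vec) \<Rightarrow> bool" where
  "bilinear_map e f g \<beta> \<longleftrightarrow>
     (\<forall>u\<in>carrier_vec e. \<forall>v\<in>carrier_vec f. \<beta> u v \<in> carrier_vec g) \<and>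
     (\<forall>u\<in>carrier_vec e. \<forall>u'\<in>carrier_vec e. \<forall>v\<in>carrier_vec f. \<beta> (u + u') v = \<beta> u v + \<beta> u' v) \<and>
     (\<forall>u\<in>carrier_vec e. \<forall>v\<in>carrier_vec f. \<forall>v'\<in>carrier_vec f. \<beta> u (v + v') = \<beta> u v + \<beta> u v') \<and>
     (\<forall>c. \<forall>u\<in>carrier_vec e. \<forall>v\<in>carrier_vec f.
        \<beta> (c \<cdot>\<^sub>v u) v = c \<cdot>\<^sub>v \<beta> u v \<and> \<beta> u (c \<cdot>\<^sub>v v) = c \<cdot>\<^sub>v \<beta> u v)"

definition represents ::
    "real mat \<Rightarrow> real mat \<Rightarrow> real mat \<Rightarrow> (real vec \<Rightarrow> real vec \<Rightarrow> real vec) \<Rightarrow> bool" where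
  "represents L R P \<beta> \<longleftrightarrow>
     (\<forall>u\<in>carrier_vec (dim_col L). \<forall>v\<in>carrier_vec (dim_col R).
        \<beta> u v = vec (dim_row P)
          (\<lambda>j. \<Sum>i<dim_col P. P $$ (j, i) * (row L i \<bullet> u) * (row R i \<bullet> v)))"

definition block :: "nat \<Rightarrow> real vec \<Rightarrow> nat \<Rightarrow> real vec" where
  "block N u j = vec N (\<lambda>c. u $ (j * N + c))"

text \<open>\<open>stack n N B\<close> is the concatenation of the \<open>n\<close> blocks \<open>B 0, \<dots>, B (n - 1)\<close> of length \<open>N\<close>.\<close>

definition stack :: "nat \<Rightarrow> nat \<Rightarrow> (nat \<Rightarrow> real vec) \<Rightarrow> real vec" where
  "stack n N B = vec (n * N) (\<lambda>t. B (t div N) $ (t mod N))"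

definition lin_comb :: "nat \<Rightarrow> real vec \<Rightarrow> (nat \<Rightarrow> real vec) \<Rightarrow> real vec" where
  "lin_comb N a B = vec N (\<lambda>c. \<Sum>j<dim_vec a. a $ j * B j $ c)"

primrec bilin_pow ::
    "real mat \<Rightarrow> real mat \<Rightarrow> real mat \<Rightarrow> nat \<Rightarrow> nat \<Rightarrow> nat \<Rightarrow>
     (real vec \<Rightarrow> real vec \<Rightarrow> real vec) \<Rightarrow> nat \<Rightarrow> real vec \<Rightarrow> real vec \<Rightarrow> real vec" where
  "bilin_pow L R P e0 f0 g0 \<beta>0 0 u v = \<beta>0 u v"
| "bilin_pow L R P e0 f0 g0 \<beta>0 (Suc l) u v =
     (let M = e0 * dim_col L ^ l; N = f0 * dim_col R ^ l; K = g0 * dim_row P ^ l in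
      stack (dim_row P) K (\<lambda>J. lin_comb K (row P J)
        (\<lambda>i. bilin_pow L R P e0 f0 g0 \<beta>0 l
               (lin_comb M (row L i) (block M u))
               (lin_comb N (row R i) (block N v)))))"

section \<open>Growth and amplification factors\<close>

definition growth_factor :: "ereal \<Rightarrow> ereal \<Rightarrow> real mat \<Rightarrow> real mat \<Rightarrow> real mat \<Rightarrow> real" where
  "growth_factor p q L R P = lp_norm p (vec (dim_row P) (\<lambda>j. \<Sum>i<dim_col P.
     lp_norm (conj_exponent q) (row L i) * lp_norm (conj_exponent q) (row R i) * \<bar>P $$ (j, i)\<bar>))"

text \<open>The bijections \<open>\<sigma>A, \<sigma>B, \<sigma>C\<close> give the positions at which the entries of the three matrices are
  stored. Storing the matrices of the \<open>l\<close>-th level block-recursively, in the order given by \<open>\<beta>\<close>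
  for the blocks and by \<open>\<beta>0\<close> inside the innermost blocks, makes \<^const>\<open>bilin_pow\<close> a matrix
  multiplication again.\<close>

definition encodes_matmul ::
    "nat \<Rightarrow> nat \<Rightarrow> nat \<Rightarrow> nat \<Rightarrow> nat \<Rightarrow> nat \<Rightarrow> (real vec \<Rightarrow> real vec \<Rightarrow> real vec) \<Rightarrow> bool" where
  "encodes_matmul m k n e f g \<beta> \<longleftrightarrow>
     e = m * k \<and> f = k * n \<and> g = m * n \<and>
     (\<exists>\<sigma>A \<sigma>B \<sigma>C.
        bij_betw \<sigma>A ({..<m} \<times> {..<k}) {..<e} \<and>
        bij_betw \<sigma>B ({..<k} \<times> {..<n}) {..<f} \<and>
        bij_betw \<sigma>C ({..<m} \<times> {..<n}) {..<g} \<and>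
        (\<forall>u\<in>carrier_vec e. \<forall>v\<in>carrier_vec f. \<forall>i<m. \<forall>j<n.
           \<beta> u v $ \<sigma>C (i, j) = (\<Sum>h<k. u $ \<sigma>A (i, h) * v $ \<sigma>B (h, j))))"

text \<open>Meant for \<open>p, q \<in> {2, \<infinity>}\<close>. For \<open>p = 2\<close> and \<open>q = \<infinity>\<close>, the value \<open>k powr (3/2)\<close> by itself is
  too small unless \<open>m * n \<le> k\<close>: the product of an \<open>m \<times> k\<close> and a \<open>k \<times> n\<close> matrix of ones has
  Frobenius norm \<open>k * sqrt (m * n)\<close>.\<close>

definition matmul_factor :: "ereal \<Rightarrow> ereal \<Rightarrow> nat \<Rightarrow> nat \<Rightarrow> nat \<Rightarrow> real" where
  "matmul_factor p q m k n =
     (if q = 2 then 1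
      else if p = \<infinity> then real k
      else max (real k powr (3 / 2)) (real k * sqrt (real m * real n)))"

text \<open>In the generic case \<open>\<Gamma>0\<close> is any constant bounding \<open>\<beta>0\<close> and \<open>\<Gamma>\<close> is the growth factor.\<close>

definition amplification_factors ::
    "ereal \<Rightarrow> ereal \<Rightarrow> real mat \<Rightarrow> real mat \<Rightarrow> real mat \<Rightarrow> (real vec \<Rightarrow> real vec \<Rightarrow> real vec) \<Rightarrow>
     nat \<Rightarrow> nat \<Rightarrow> nat \<Rightarrow> (real vec \<Rightarrow> real vec \<Rightarrow> real vec) \<Rightarrow> real \<Rightarrow> real \<Rightarrow> bool" where
  "amplification_factors p q L R P \<beta> e0 f0 g0 \<beta>0 \<Gamma>0 \<Gamma> \<longleftrightarrow>
     (if p \<in> {2, \<infinity>} \<and> q \<in> {2, \<infinity>} \<and>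
         (\<exists>m k n. encodes_matmul m k n (dim_col L) (dim_col R) (dim_row P) \<beta>) \<and>
         (\<exists>m0 k0 n0. encodes_matmul m0 k0 n0 e0 f0 g0 \<beta>0)
      then
        (\<exists>m k n. encodes_matmul m k n (dim_col L) (dim_col R) (dim_row P) \<beta> \<and>
           \<Gamma> = matmul_factor p q m k n) \<and>
        (\<exists>m0 k0 n0. encodes_matmul m0 k0 n0 e0 f0 g0 \<beta>0 \<and>
           \<Gamma>0 = matmul_factor p q m0 k0 n0)
      else
        \<Gamma> = growth_factor p q L R P \<and>
        (\<forall>u\<in>carrier_vec e0. \<forall>v\<in>carrier_vec f0.
           lp_norm p (\<beta>0 u v) \<le> \<Gamma>0 * lp_norm q u * lp_norm q v))"

definition Q0 :: "real mat \<Rightarrow> real mat \<Rightarrow> real mat \<Rightarrow> nat" where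
  "Q0 L R P = Max ((\<lambda>j. nnz (row P j) +
     Max ((\<lambda>i. if P $$ (j, i) \<noteq> 0 then nnz (row L i) + nnz (row R i) else 0) ` {..<dim_col P}))
     ` {..<dim_row P})"

section \<open>Floating point evaluation\<close>

text \<open>Rounding is nondeterministic: a computation is described by the relation between its exact
  inputs and all values it may return at precision \<open>\<epsilon>\<close>.\<close>

definition rounds_to :: "real \<Rightarrow> real \<Rightarrow> real \<Rightarrow> bool" where
  "rounds_to \<epsilon> x y \<longleftrightarrow> (\<exists>\<delta>. \<bar>\<delta>\<bar> \<le> \<epsilon> \<and> y = x * (1 + \<delta>))"

text \<open>The splitting \<open>X + Y\<close> of the multiset of summands is arbitrary, so that every order and every
  parenthesization of the summation is covered.\<close>

inductive fl_sum :: "real \<Rightarrow> real multiset \<Rightarrow> real \<Rightarrow> bool" for \<epsilon> where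
  empty: "fl_sum \<epsilon> {#} 0"
| single: "fl_sum \<epsilon> {#x#} x"
| plus: "X \<noteq> {#} \<Longrightarrow> Y \<noteq> {#} \<Longrightarrow> fl_sum \<epsilon> X x \<Longrightarrow> fl_sum \<epsilon> Y y \<Longrightarrow> rounds_to \<epsilon> (x + y) z \<Longrightarrow>
    fl_sum \<epsilon> (X + Y) z"

definition fl_dot :: "real \<Rightarrow> real vec \<Rightarrow> (nat \<Rightarrow> real) \<Rightarrow> real \<Rightarrow> bool" where
  "fl_dot \<epsilon> a x s \<longleftrightarrow>
     (let J = {j. j < dim_vec a \<and> a $ j \<noteq> 0} in
      \<exists>t. (\<forall>j\<in>J. rounds_to \<epsilon> (a $ j * x j) (t j)) \<and> fl_sum \<epsilon> (image_mset t (mset_set J)) s)"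

definition fl_lin_comb :: "real \<Rightarrow> nat \<Rightarrow> real vec \<Rightarrow> (nat \<Rightarrow> real vec) \<Rightarrow> real vec \<Rightarrow> bool" where
  "fl_lin_comb \<epsilon> N a B w \<longleftrightarrow>
     w \<in> carrier_vec N \<and> (\<forall>c<N. fl_dot \<epsilon> a (\<lambda>j. B j $ c) (w $ c))"

type_synonym fl_bilinear = "real \<Rightarrow> real vec \<Rightarrow> real vec \<Rightarrow> real vec \<Rightarrow> bool"

definition fl_algorithm :: "nat \<Rightarrow> nat \<Rightarrow> nat \<Rightarrow> fl_bilinear \<Rightarrow> bool" where
  "fl_algorithm e f g A \<longleftrightarrow>
     (\<forall>\<epsilon>>0. \<forall>u\<in>carrier_vec e. \<forall>v\<in>carrier_vec f.
        (\<exists>w. A \<epsilon> u v w) \<and> (\<forall>w. A \<epsilon> u v w \<longrightarrow> w \<in> carrier_vec g))"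

text \<open>\<open>A0 \<epsilon> u v w\<close> means that the base case algorithm may return \<open>w\<close> on the inputs \<open>u, v\<close>.\<close>

primrec fl_bilin_pow ::
    "real mat \<Rightarrow> real mat \<Rightarrow> real mat \<Rightarrow> nat \<Rightarrow> nat \<Rightarrow> nat \<Rightarrow> fl_bilinear \<Rightarrow> nat \<Rightarrow> fl_bilinear" where
  "fl_bilin_pow L R P e0 f0 g0 A0 0 = A0"
| "fl_bilin_pow L R P e0 f0 g0 A0 (Suc l) = (\<lambda>\<epsilon> u v w.
     let M = e0 * dim_col L ^ l; N = f0 * dim_col R ^ l; K = g0 * dim_row P ^ l in
     \<exists>x y z W.
       (\<forall>i<dim_col P.
          fl_lin_comb \<epsilon> M (row L i) (block M u) (x i) \<and>
          fl_lin_comb \<epsilon> N (row R i) (block N v) (y i) \<and>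
          fl_bilin_pow L R P e0 f0 g0 A0 l \<epsilon> (x i) (y i) (z i)) \<and>
       (\<forall>J<dim_row P. fl_lin_comb \<epsilon> K (row P J) z (W J)) \<and>
       w = stack (dim_row P) K W)"

text \<open>The \<open>O(\<epsilon>\<^sup>2)\<close> term is uniform over bounded sets of inputs.\<close>

definition forward_error_bound ::
    "ereal \<Rightarrow> ereal \<Rightarrow> nat \<Rightarrow> nat \<Rightarrow> (real vec \<Rightarrow> real vec \<Rightarrow> real vec) \<Rightarrow> fl_bilinear \<Rightarrow> real \<Rightarrow> bool" where
  "forward_error_bound p q e f \<beta> A F \<longleftrightarrow>
     (\<forall>B. \<exists>C. \<forall>\<^sub>F \<epsilon> in at_right 0.
        \<forall>u\<in>carrier_vec e. \<forall>v\<in>carrier_vec f. \<forall>w.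
          lp_norm q u \<le> B \<longrightarrow> lp_norm q v \<le> B \<longrightarrow> A \<epsilon> u v w \<longrightarrow>
          lp_norm p (w - \<beta> u v) \<le> F * lp_norm q u * lp_norm q v * \<epsilon> + C * \<epsilon>\<^sup>2)"

end

theory Submission
  imports Defs "HOL-Analysis.Convex"
begin

text \<open>
  The factors satisfy a recurrence. Suppose that the map of the level below is computed with error
  factor \<open>F\<close> and that \<open>G\<close> bounds its norm, \<open>\<parallel>\<beta>(u, v)\<parallel>\<^sub>p \<le> G \<parallel>u\<parallel>\<^sub>q \<parallel>v\<parallel>\<^sub>q\<close>. In a linear combination
  with \<open>n\<close> nonzero coefficients every summand collects at most \<open>n\<close> factors \<open>1 + \<delta>\<close>, whatever the order
  of summation, so the error is at most \<open>(1 + \<epsilon>)\<^sup>n - 1\<close> times the sum of the absolute values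
  (\<open>fl_lin_comb_error\<close>). For the rows of \<open>L\<close> and \<open>R\<close>, Hoelder's inequality over the blocks turns that
  sum into \<open>\<parallel>L\<^sub>i\<parallel>\<^bsub>q*\<^esub> \<parallel>u\<parallel>\<^sub>q\<close>. Bilinearity passes the errors of the two arguments on to the recursive call,
  amplified by \<open>G\<close>. Because \<open>(x - 1) y + (y - 1) = x y - 1\<close>, the roundings in row \<open>i\<close> of \<open>L\<close>, in row \<open>i\<close> of
  \<open>R\<close> and in row \<open>J\<close> of \<open>P\<close> together cost a single \<open>(1 + \<epsilon>)\<^sup>s - 1\<close>, where \<open>s\<close> counts the nonzero entries of
  the three rows; \<open>Q0\<close> is the largest such \<open>s\<close> over all nonzero entries \<open>P $$ (J, i)\<close>.
  Minkowski's inequality over the output blocks then gives the factor \<open>\<gamma> (F + Q0 G)\<close> for the next level (\<open>step_error\<close>, \<open>forward_error_bound_step\<close>). With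
  \<open>G = \<Gamma>0 \<Gamma>\<^sup>l\<close> at level \<open>l\<close>, unrolling this recurrence yields the claimed geometric sum.

  What remains is the bound \<open>\<Gamma>0 \<Gamma>\<^sup>l\<close> on the norm of the exact map. In general, the same estimate without
  rounding costs a factor \<open>\<gamma>\<close> per level (\<open>bilin_pow_norm_growth\<close>). If both \<open>\<beta>\<close> and \<open>\<beta>0\<close> are matrix
  multiplications, then level \<open>l\<close> is a matrix multiplication of the multiplied dimensions
  (\<open>encodes_matmul_bilin_pow\<close>). Its norm is bounded directly, by Cauchy-Schwarz or by counting the
  summands, and these bounds are multiplicative in the dimensions.

  The recurrence uses \<open>F0 \<ge> 0\<close> and \<open>\<Gamma>0 \<ge> 0\<close>. Where no formula shows it, this follows by testing
  the hypotheses on nonzero inputs, unless one of the two input spaces is zero-dimensional; in that case \<open>\<parallel>u\<parallel>\<^sub>q \<parallel>v\<parallel>\<^sub>q = 0\<close> for all inputs, and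
  \<open>0\<close> can take the place of both constants.
\<close>

(* The dot stands for the scalar product of coordinate vectors throughout. *)
unbundle no inner_syntax

section \<open>Norms\<close>

text \<open>The norm of the values of a function on a finite set. Index sets other than initial segments are
  needed because blocks are indexed by pairs and the entries of a matrix by rows and columns.\<close>

definition lp_set :: "ereal \<Rightarrow> ('a \<Rightarrow> real) \<Rightarrow> 'a set \<Rightarrow> real" where
  "lp_set p f A =
     (if p = \<infinity> then Max (insert 0 ((\<lambda>i. \<bar>f i\<bar>) ` A))
      else (\<Sum>i\<in>A. \<bar>f i\<bar> powr real_of_ereal p) powr (1 / real_of_ereal p))"

lemma lp_norm_eq_lp_set: "lp_norm p x = lp_set p (($) x) {..<dim_vec x}"
  by (simp add: lp_norm_def lp_set_def)

lemma exponent_cases: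
  fixes p :: ereal
  assumes "1 \<le> p"
  obtains "p = \<infinity>" | s where "p = ereal s" "1 \<le> s"
  using assms by (cases p) (auto simp: one_ereal_def)

lemma lp_set_infty_le_iff:
  assumes "finite A" "0 \<le> s"
  shows "lp_set \<infinity> f A \<le> s \<longleftrightarrow> (\<forall>i\<in>A. \<bar>f i\<bar> \<le> s)"
  using assms by (simp add: lp_set_def)

lemma lp_set_infty_upper:
  assumes "finite A" "i \<in> A"
  shows "\<bar>f i\<bar> \<le> lp_set \<infinity> f A"
  using assms by (simp add: lp_set_def)

lemma lp_set_ereal:
  "lp_set (ereal s) f A = (\<Sum>i\<in>A. \<bar>f i\<bar> powr s) powr (1 / s)"
  by (simp add: lp_set_def)

lemma lp_set_nonneg [simp]:
  assumes "finite A"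
  shows "0 \<le> lp_set p f A"
  using assms by (simp add: lp_set_def)

lemma lp_set_powr:
  assumes "1 \<le> s"
  shows "lp_set (ereal s) f A powr s = (\<Sum>i\<in>A. \<bar>f i\<bar> powr s)"
  using assms by (simp add: lp_set_ereal powr_powr sum_nonneg)

lemma lp_set_cong:
  assumes "A = B" "\<And>i. i \<in> B \<Longrightarrow> \<bar>f i\<bar> = \<bar>g i\<bar>"
  shows "lp_set p f A = lp_set p g B"
  using assms by (simp add: lp_set_def)

lemma lp_set_reindex:
  assumes "bij_betw h A B"
  shows "lp_set p f B = lp_set p (\<lambda>i. f (h i)) A"
proof -
  have "B = h ` A" "inj_on h A" using assms by (auto simp: bij_betw_def)
  then show ?thesis by (simp add: lp_set_def sum.reindex image_image)
qed

lemma lp_set_mono: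
  assumes "finite A" "1 \<le> p" "\<And>i. i \<in> A \<Longrightarrow> \<bar>f i\<bar> \<le> \<bar>g i\<bar>"
  shows "lp_set p f A \<le> lp_set p g A"
  using assms(2)
proof (cases rule: exponent_cases)
  case 1
  have "\<bar>f i\<bar> \<le> lp_set \<infinity> g A" if "i \<in> A" for i
    using assms(3)[OF that] lp_set_infty_upper[OF assms(1) that, of g] by linarith
  then show ?thesis using 1 assms(1) by (simp add: lp_set_infty_le_iff)
next
  case (2 s)
  then show ?thesis using assms
    by (auto simp: lp_set_ereal intro!: powr_mono2 sum_mono sum_nonneg)
qed

lemma lp_set_scale:
  assumes "finite A" "1 \<le> p"
  shows "lp_set p (\<lambda>i. c * f i) A = \<bar>c\<bar> * lp_set p f A"
  using assms(2)
proof (cases rule: exponent_cases)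
  case 1
  have le: "lp_set \<infinity> (\<lambda>i. c * f i) A \<le> \<bar>c\<bar> * lp_set \<infinity> f A" for c and f :: "'a \<Rightarrow> real"
    using assms(1)
    by (auto simp: lp_set_infty_le_iff abs_mult intro!: mult_left_mono lp_set_infty_upper)
  show ?thesis
  proof (cases "c = 0")
    case True
    have "lp_set \<infinity> (\<lambda>i. c * f i) A = 0"
      using le[of c f] True assms(1) by (simp add: order_antisym)
    then show ?thesis using 1 True by simp
  next
    case False
    have "lp_set \<infinity> f A \<le> \<bar>1 / c\<bar> * lp_set \<infinity> (\<lambda>i. c * f i) A"
      using le[of "1 / c" "\<lambda>i. c * f i"] False by simp
    then have "\<bar>c\<bar> * lp_set \<infinity> f A \<le> lp_set \<infinity> (\<lambda>i. c * f i) A"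
      using False by (simp add: field_simps)
    with le[of c f] 1 show ?thesis by simp
  qed
next
  case (2 s)
  then show ?thesis using assms
    by (simp add: lp_set_ereal abs_mult powr_mult powr_powr sum_nonneg flip: sum_distrib_left)
qed

lemma lp_set_eq_0D:
  assumes "finite A" "1 \<le> p" "lp_set p f A = 0" "i \<in> A"
  shows "f i = 0"
  using assms(2)
proof (cases rule: exponent_cases)
  case 1
  then show ?thesis using lp_set_infty_upper[OF assms(1,4), of f] assms(3) by simp
next
  case (2 s)
  then have "(\<Sum>i\<in>A. \<bar>f i\<bar> powr s) = 0"
    using assms(3) lp_set_powr[of s f A] by simp
  then show ?thesis using assms(1,4) by (simp add: sum_nonneg_eq_0_iff)
qed

lemma lp_set_eq_0I:
  assumes "finite A" "1 \<le> p" "\<And>i. i \<in> A \<Longrightarrow> f i = 0"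
  shows "lp_set p f A = 0"
proof -
  have "lp_set p f A = lp_set p (\<lambda>i. 0 * f i) A"
    by (rule lp_set_cong) (simp_all add: assms)
  then show ?thesis using assms lp_set_scale[of A p 0 f] by simp
qed

text \<open>Extends the convexity of \<open>x powr s\<close> on the positive reals to the end point \<open>0\<close>.\<close>

lemma powr_convex_nonneg:
  fixes x y t s :: real
  assumes "1 \<le> s" "0 \<le> x" "0 \<le> y" "0 \<le> t" "t \<le> 1"
  shows "((1 - t) * x + t * y) powr s \<le> (1 - t) * x powr s + t * y powr s"
proof -
  have scale: "(t * y) powr s \<le> t * y powr s" if "0 \<le> t" "t \<le> 1" "0 \<le> y" for t y :: real
  proof -
    have "t powr s \<le> t powr 1" using that assms(1) by (intro powr_mono') auto
    then have "t powr s \<le> t" using that by simp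
    then show ?thesis using that by (simp add: powr_mult mult_right_mono)
  qed
  consider "x = 0" | "y = 0" | "0 < x" "0 < y" using assms by linarith
  then show ?thesis
  proof cases
    case 3
    then show ?thesis
      using convex_onD[OF powr_convex[OF assms(1)], of t x y] assms by simp
  qed (use scale[of t y] scale[of "1 - t" x] assms in auto)
qed

text \<open>Minkowski's inequality: \<open>f + g\<close> is \<open>a + b\<close> times a convex combination of the normalized functions
  \<open>f / a\<close> and \<open>g / b\<close>, where \<open>a\<close> and \<open>b\<close> are the norms of \<open>f\<close> and \<open>g\<close>, and the power \<open>s\<close> is convex.\<close>

lemma lp_set_triangle:
  assumes "finite A" "1 \<le> p"
  shows "lp_set p (\<lambda>i. f i + g i) A \<le> lp_set p f A + lp_set p g A"
  using assms(2)
proof (cases rule: exponent_cases)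
  case 1
  have "\<bar>f i + g i\<bar> \<le> lp_set \<infinity> f A + lp_set \<infinity> g A" if "i \<in> A" for i
    using lp_set_infty_upper[OF assms(1) that, of f] lp_set_infty_upper[OF assms(1) that, of g]
    by linarith
  then show ?thesis using 1 assms(1) by (simp add: lp_set_infty_le_iff)
next
  case (2 s)
  define a where "a = lp_set p f A"
  define b where "b = lp_set p g A"
  have nn: "0 \<le> a" "0 \<le> b" using assms by (simp_all add: a_def b_def)
  consider "a = 0" | "b = 0" | "0 < a" "0 < b" using nn by linarith
  then show ?thesis
  proof cases
    assume "a = 0"
    then have "lp_set p (\<lambda>i. f i + g i) A = b" unfolding b_def
      by (intro lp_set_cong) (auto simp: a_def dest: lp_set_eq_0D[OF assms])
    then show ?thesis using nn by (simp add: a_def b_def)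
  next
    assume "b = 0"
    then have "lp_set p (\<lambda>i. f i + g i) A = a" unfolding a_def
      by (intro lp_set_cong) (auto simp: b_def dest: lp_set_eq_0D[OF assms])
    then show ?thesis using nn by (simp add: a_def b_def)
  next
    assume pos: "0 < a" "0 < b"
    have as: "(\<Sum>i\<in>A. \<bar>f i\<bar> powr s) = a powr s" and bs: "(\<Sum>i\<in>A. \<bar>g i\<bar> powr s) = b powr s"
      using 2 by (simp_all add: a_def b_def lp_set_powr)
    define t where "t = b / (a + b)"
    have t: "0 \<le> t" "t \<le> 1" "(a + b) * (1 - t) = a" "(a + b) * t = b"
      using pos by (auto simp: t_def field_simps)
    have "\<bar>f i + g i\<bar> powr s
        \<le> (a + b) powr s * ((1 - t) * (\<bar>f i\<bar> powr s / a powr s) + t * (\<bar>g i\<bar> powr s / b powr s))"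
      for i
    proof -
      have "\<bar>f i\<bar> + \<bar>g i\<bar> = (a + b) * (1 - t) * (\<bar>f i\<bar> / a) + (a + b) * t * (\<bar>g i\<bar> / b)"
        unfolding t(3) t(4) using pos by simp
      also have "\<dots> = (a + b) * ((1 - t) * (\<bar>f i\<bar> / a) + t * (\<bar>g i\<bar> / b))"
        by (simp only: distrib_left mult.assoc)
      finally have eq: "\<bar>f i\<bar> + \<bar>g i\<bar> = (a + b) * ((1 - t) * (\<bar>f i\<bar> / a) + t * (\<bar>g i\<bar> / b))" .
      have "\<bar>f i + g i\<bar> powr s \<le> (\<bar>f i\<bar> + \<bar>g i\<bar>) powr s"
        using 2 by (intro powr_mono2) auto
      also have "\<dots> = (a + b) powr s * ((1 - t) * (\<bar>f i\<bar> / a) + t * (\<bar>g i\<bar> / b)) powr s"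
        using pos t by (simp add: eq powr_mult)
      also have "\<dots> \<le> (a + b) powr s * ((1 - t) * (\<bar>f i\<bar> / a) powr s + t * (\<bar>g i\<bar> / b) powr s)"
        using 2 pos t by (intro mult_left_mono powr_convex_nonneg) auto
      finally show ?thesis using pos by (simp add: powr_divide)
    qed
    then have "(\<Sum>i\<in>A. \<bar>f i + g i\<bar> powr s) \<le> (\<Sum>i\<in>A. (a + b) powr s *
        ((1 - t) * (\<bar>f i\<bar> powr s / a powr s) + t * (\<bar>g i\<bar> powr s / b powr s)))"
      by (intro sum_mono)
    also have "\<dots> = (a + b) powr s *
        ((1 - t) * ((\<Sum>i\<in>A. \<bar>f i\<bar> powr s) / a powr s) + t * ((\<Sum>i\<in>A. \<bar>g i\<bar> powr s) / b powr s))"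
      by (simp add: sum.distrib flip: sum_distrib_left sum_divide_distrib)
    also have "\<dots> = (a + b) powr s" using pos by (simp add: as bs)
    finally have "lp_set p (\<lambda>i. f i + g i) A \<le> ((a + b) powr s) powr (1 / s)"
      using 2 by (auto simp: lp_set_ereal intro!: powr_mono2 sum_nonneg)
    also have "\<dots> = a + b" using pos 2 by (simp add: powr_powr)
    finally show ?thesis by (simp add: a_def b_def)
  qed
qed

lemma lp_set_sum:
  assumes "finite A" "1 \<le> p"
  shows "lp_set p (\<lambda>i. \<Sum>j\<in>J. f j i) A \<le> (\<Sum>j\<in>J. lp_set p (f j) A)"
proof (induction J rule: infinite_finite_induct)
  case (insert j J)
  then show ?case
    using lp_set_triangle[OF assms, of "f j" "\<lambda>i. \<Sum>j\<in>J. f j i"] by simp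
qed (use assms in \<open>auto intro: lp_set_eq_0I order.refl eq_refl\<close>)

lemma Hoelder_infinity_1:
  assumes "finite A"
  shows "(\<Sum>j\<in>A. \<bar>a j\<bar> * \<bar>x j\<bar>) \<le> lp_set \<infinity> a A * lp_set 1 x A"
proof -
  have "(\<Sum>j\<in>A. \<bar>a j\<bar> * \<bar>x j\<bar>) \<le> (\<Sum>j\<in>A. lp_set \<infinity> a A * \<bar>x j\<bar>)"
    using assms by (intro sum_mono mult_right_mono lp_set_infty_upper) auto
  also have "\<dots> = lp_set \<infinity> a A * lp_set 1 x A"
    using lp_set_ereal[of 1 x A] by (simp add: sum_nonneg one_ereal_def flip: sum_distrib_left)
  finally show ?thesis .
qed

text \<open>For finite exponents, Young's inequality is summed over the entries of \<open>a\<close> and \<open>x\<close> after scaling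
  both to norm one.\<close>

lemma Hoelder_lp_set:
  assumes "finite A" "1 \<le> q"
  shows "(\<Sum>j\<in>A. \<bar>a j\<bar> * \<bar>x j\<bar>) \<le> lp_set (conj_exponent q) a A * lp_set q x A"
proof -
  consider "q = 1" | "q = \<infinity>" | s where "q = ereal s" "1 < s"
    using assms(2) by (cases q) (force simp: one_ereal_def)+
  then show ?thesis
  proof cases
    case 1
    then have "conj_exponent q = \<infinity>" by (simp add: conj_exponent_def one_ereal_def zero_ereal_def)
    then show ?thesis using Hoelder_infinity_1[OF assms(1)] 1 by simp
  next
    case 2
    then have "conj_exponent q = 1" by (simp add: conj_exponent_def)
    then show ?thesis using Hoelder_infinity_1[OF assms(1), of x a] 2 by (simp add: mult.commute)
  next
    case (3 s)
    define r where "r = 1 / (1 - 1 / s)"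
    have r: "1 < r" "1 / r + 1 / s = 1" using 3 by (auto simp: r_def field_simps)
    have cr: "conj_exponent q = ereal r"
      using 3 by (auto simp: conj_exponent_def one_ereal_def r_def)
    define \<alpha> where "\<alpha> = lp_set (conj_exponent q) a A"
    define \<xi> where "\<xi> = lp_set q x A"
    have nn: "0 \<le> \<alpha>" "0 \<le> \<xi>" using assms by (simp_all add: \<alpha>_def \<xi>_def)
    have "(\<Sum>j\<in>A. \<bar>a j\<bar> * \<bar>x j\<bar>) \<le> \<alpha> * \<xi>"
    proof (cases "\<alpha> = 0 \<or> \<xi> = 0")
      case True
      then have "a j = 0 \<or> x j = 0" if "j \<in> A" for j
        using lp_set_eq_0D[OF assms(1) _ _ that] conj_exponent(2)[OF assms(2)] assms(2)
        by (auto simp: \<alpha>_def \<xi>_def)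
      then have "(\<Sum>j\<in>A. \<bar>a j\<bar> * \<bar>x j\<bar>) = 0" by (intro sum.neutral) force
      then show ?thesis using nn by simp
    next
      case False
      then have pos: "0 < \<alpha>" "0 < \<xi>" using nn by auto
      have as: "(\<Sum>i\<in>A. \<bar>a i\<bar> powr r) = \<alpha> powr r" and xs: "(\<Sum>i\<in>A. \<bar>x i\<bar> powr s) = \<xi> powr s"
        unfolding \<alpha>_def \<xi>_def cr using r 3 by (simp_all add: lp_set_powr)
      have "\<bar>a j\<bar> * \<bar>x j\<bar> \<le> \<alpha> * \<xi> * (\<bar>a j\<bar> powr r / \<alpha> powr r / r + \<bar>x j\<bar> powr s / \<xi> powr s / s)" for j
      proof -
        have "(\<bar>a j\<bar> / \<alpha>) * (\<bar>x j\<bar> / \<xi>) \<le> (\<bar>a j\<bar> / \<alpha>) powr r / r + (\<bar>x j\<bar> / \<xi>) powr s / s"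
          using r 3 pos by (intro Youngs_inequality) auto
        then have "\<alpha> * \<xi> * ((\<bar>a j\<bar> / \<alpha>) * (\<bar>x j\<bar> / \<xi>)) \<le>
            \<alpha> * \<xi> * ((\<bar>a j\<bar> / \<alpha>) powr r / r + (\<bar>x j\<bar> / \<xi>) powr s / s)"
          using pos by (intro mult_left_mono) auto
        then show ?thesis using pos by (simp add: powr_divide)
      qed
      then have "(\<Sum>j\<in>A. \<bar>a j\<bar> * \<bar>x j\<bar>) \<le>
          (\<Sum>j\<in>A. \<alpha> * \<xi> * (\<bar>a j\<bar> powr r / \<alpha> powr r / r + \<bar>x j\<bar> powr s / \<xi> powr s / s))"
        by (intro sum_mono)
      also have "\<dots> = \<alpha> * \<xi> * ((\<Sum>j\<in>A. \<bar>a j\<bar> powr r) / \<alpha> powr r / r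
          + (\<Sum>j\<in>A. \<bar>x j\<bar> powr s) / \<xi> powr s / s)"
        by (simp add: sum.distrib flip: sum_distrib_left sum_divide_distrib)
      also have "\<dots> = \<alpha> * \<xi>" using pos r(2) by (simp add: as xs)
      finally show ?thesis .
    qed
    then show ?thesis by (simp add: \<alpha>_def \<xi>_def)
  qed
qed

text \<open>The norm of a matrix of entries is the norm of the vector of row norms. This is what allows a vector
  to be estimated block by block.\<close>

lemma lp_set_Times:
  assumes "finite A" "finite B" "1 \<le> p"
  shows "lp_set p (\<lambda>(i, j). f i j) (A \<times> B) = lp_set p (\<lambda>i. lp_set p (f i) B) A"
  using assms(3)
proof (cases rule: exponent_cases)
  case 1
  show ?thesis unfolding 1
  proof (rule antisym)
    have "\<bar>f i j\<bar> \<le> lp_set \<infinity> (\<lambda>i. lp_set \<infinity> (f i) B) A" if "i \<in> A" "j \<in> B" for i j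
      using lp_set_infty_upper[OF assms(2) that(2), of "f i"]
        lp_set_infty_upper[OF assms(1) that(1), of "\<lambda>i. lp_set \<infinity> (f i) B"] by linarith
    then show "lp_set \<infinity> (\<lambda>(i, j). f i j) (A \<times> B) \<le> lp_set \<infinity> (\<lambda>i. lp_set \<infinity> (f i) B) A"
      using assms by (simp add: lp_set_infty_le_iff)
    show "lp_set \<infinity> (\<lambda>i. lp_set \<infinity> (f i) B) A \<le> lp_set \<infinity> (\<lambda>(i, j). f i j) (A \<times> B)"
      using assms lp_set_infty_upper[of "A \<times> B" _ "\<lambda>(i, j). f i j"]
      by (fastforce simp: lp_set_infty_le_iff)
  qed
next
  case (2 s)
  then show ?thesis using assms
    by (simp add: lp_set_ereal powr_powr sum_nonneg sum.cartesian_product case_prod_beta)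
qed

section \<open>Vectors cut into blocks\<close>

lemma dim_block [simp]: "dim_vec (block N u j) = N"
  and index_block [simp]: "c < N \<Longrightarrow> block N u j $ c = u $ (j * N + c)"
  and block_carrier [simp]: "block N u j \<in> carrier_vec N"
  by (simp_all add: block_def)

lemma dim_stack [simp]: "dim_vec (stack n N B) = n * N"
  and stack_carrier [simp]: "stack n N B \<in> carrier_vec (n * N)"
  by (simp_all add: stack_def)

lemma dim_lin_comb [simp]: "dim_vec (lin_comb N a B) = N"
  and index_lin_comb [simp]: "c < N \<Longrightarrow> lin_comb N a B $ c = (\<Sum>j<dim_vec a. a $ j * B j $ c)"
  and lin_comb_carrier [simp]: "lin_comb N a B \<in> carrier_vec N"
  by (simp_all add: lin_comb_def)

lemma block_index_less:
  fixes J c n N :: nat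
  assumes "J < n" "c < N"
  shows "J * N + c < n * N"
proof -
  have "J * N + c < Suc J * N" using assms by simp
  also have "\<dots> \<le> n * N" using assms by (intro mult_le_mono1) simp
  finally show ?thesis .
qed

lemma block_coordinates:
  fixes t n N :: nat
  assumes "t < n * N"
  shows "t div N < n" "t mod N < N"
  using assms by (auto simp: less_mult_imp_div_less) (metis gr0I mod_less_divisor mult_0_right not_less0)

lemma index_stack:
  assumes "J < n" "c < N"
  shows "stack n N B $ (J * N + c) = B J $ c"
  using assms block_index_less[OF assms] by (simp add: stack_def)

lemma bij_betw_block_index:
  "bij_betw (\<lambda>(J, c). J * N + c) ({..<n} \<times> {..<N}) {..<n * N :: nat}"
proof (rule bij_betwI[where g = "\<lambda>t. (t div N, t mod N)"])
  show "(\<lambda>(J, c). J * N + c) \<in> {..<n} \<times> {..<N} \<rightarrow> {..<n * N}"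
    using block_index_less by auto
  show "(\<lambda>t. (t div N, t mod N)) \<in> {..<n * N} \<rightarrow> {..<n} \<times> {..<N}"
    using block_coordinates by auto
qed auto

lemma stack_block:
  assumes "u \<in> carrier_vec (n * N)"
  shows "stack n N (block N u) = u"
proof (rule eq_vecI)
  fix t assume "t < dim_vec u"
  then have t: "t < n * N" using assms by simp
  then have "0 < N" by (metis gr0I mult_0_right not_less0)
  then show "stack n N (block N u) $ t = u $ t"
    using t by (simp add: stack_def)
qed (use assms in simp)

lemma lp_norm_stack:
  assumes "1 \<le> p" "\<And>J. J < n \<Longrightarrow> B J \<in> carrier_vec N"
  shows "lp_norm p (stack n N B) = lp_set p (\<lambda>J. lp_norm p (B J)) {..<n}"
proof -
  have "lp_norm p (stack n N B)
      = lp_set p (\<lambda>i. stack n N B $ (case i of (J, c) \<Rightarrow> J * N + c)) ({..<n} \<times> {..<N})"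
    by (simp add: lp_norm_eq_lp_set lp_set_reindex[OF bij_betw_block_index])
  also have "\<dots> = lp_set p (\<lambda>(J, c). B J $ c) ({..<n} \<times> {..<N})"
    by (rule lp_set_cong) (auto simp: index_stack)
  also have "\<dots> = lp_set p (\<lambda>J. lp_set p (\<lambda>c. B J $ c) {..<N}) {..<n}"
    using assms(1) by (simp add: lp_set_Times)
  also have "\<dots> = lp_set p (\<lambda>J. lp_norm p (B J)) {..<n}"
    using assms(2) by (intro lp_set_cong refl arg_cong[of _ _ abs]) (metis carrier_vecD lessThan_iff lp_norm_eq_lp_set)
  finally show ?thesis .
qed

lemma lin_comb_add:
  assumes "\<And>j. j < dim_vec a \<Longrightarrow> B j \<in> carrier_vec N" "\<And>j. j < dim_vec a \<Longrightarrow> B' j \<in> carrier_vec N"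
  shows "lin_comb N a (\<lambda>j. B j + B' j) = lin_comb N a B + lin_comb N a B'"
proof -
  have "dim_vec (B' j) = N" if "j < dim_vec a" for j using assms(2)[OF that] by simp
  then show ?thesis
    by (auto simp: distrib_left simp flip: sum.distrib intro!: sum.cong eq_vecI)
qed

lemma lin_comb_diff:
  assumes "\<And>j. j < dim_vec a \<Longrightarrow> B' j \<in> carrier_vec N"
  shows "lin_comb N a B - lin_comb N a B' = lin_comb N a (\<lambda>j. B j - B' j)"
proof -
  have "dim_vec (B' j) = N" if "j < dim_vec a" for j using assms[OF that] by simp
  then show ?thesis
    by (auto simp: right_diff_distrib simp flip: sum_subtractf intro!: sum.cong eq_vecI)
qed

lemma lin_comb_smult:
  assumes "\<And>j. j < dim_vec a \<Longrightarrow> B j \<in> carrier_vec N"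
  shows "lin_comb N a (\<lambda>j. k \<cdot>\<^sub>v B j) = k \<cdot>\<^sub>v lin_comb N a B"
proof -
  have "dim_vec (B j) = N" if "j < dim_vec a" for j using assms[OF that] by simp
  then show ?thesis
    by (auto simp: sum_distrib_left ac_simps intro!: sum.cong eq_vecI)
qed

lemma lin_comb_cong:
  assumes "\<And>j. j < dim_vec a \<Longrightarrow> B j = B' j"
  shows "lin_comb N a B = lin_comb N a B'"
  using assms by (simp add: lin_comb_def)

lemma block_add:
  assumes "j < n" "u \<in> carrier_vec (n * N)" "u' \<in> carrier_vec (n * N)"
  shows "block N (u + u') j = block N u j + block N u' j"
  by (rule eq_vecI) (use assms block_index_less in auto)

lemma block_smult:
  assumes "j < n" "u \<in> carrier_vec (n * N)"
  shows "block N (k \<cdot>\<^sub>v u) j = k \<cdot>\<^sub>v block N u j"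
  by (rule eq_vecI) (use assms block_index_less in auto)

lemma stack_add:
  assumes "\<And>J. J < n \<Longrightarrow> B J \<in> carrier_vec N" "\<And>J. J < n \<Longrightarrow> B' J \<in> carrier_vec N"
  shows "stack n N (\<lambda>J. B J + B' J) = stack n N B + stack n N B'"
proof (rule eq_vecI)
  fix t assume "t < dim_vec (stack n N B + stack n N B')"
  then have t: "t < n * N" by simp
  with block_coordinates[OF t] show "stack n N (\<lambda>J. B J + B' J) $ t = (stack n N B + stack n N B') $ t"
    using carrier_vecD[OF assms(2)] t by (simp add: stack_def)
qed simp

lemma stack_smult:
  assumes "\<And>J. J < n \<Longrightarrow> B J \<in> carrier_vec N"
  shows "stack n N (\<lambda>J. k \<cdot>\<^sub>v B J) = k \<cdot>\<^sub>v stack n N B"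
proof (rule eq_vecI)
  fix t assume "t < dim_vec (k \<cdot>\<^sub>v stack n N B)"
  then have t: "t < n * N" by simp
  with block_coordinates[OF t] show "stack n N (\<lambda>J. k \<cdot>\<^sub>v B J) $ t = (k \<cdot>\<^sub>v stack n N B) $ t"
    using carrier_vecD[OF assms] t by (simp add: stack_def)
qed simp

lemma stack_diff:
  assumes "\<And>J. J < n \<Longrightarrow> B J \<in> carrier_vec N" "\<And>J. J < n \<Longrightarrow> B' J \<in> carrier_vec N"
  shows "stack n N B - stack n N B' = stack n N (\<lambda>J. B J - B' J)"
proof (rule eq_vecI)
  fix t assume "t < dim_vec (stack n N (\<lambda>J. B J - B' J))"
  then have t: "t < n * N" by simp
  with block_coordinates[OF t] show "(stack n N B - stack n N B') $ t = stack n N (\<lambda>J. B J - B' J) $ t"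
    using carrier_vecD[OF assms(2)] t by (simp add: stack_def)
qed simp

lemma lp_norm_nonneg [simp]: "0 \<le> lp_norm p x"
  by (simp add: lp_norm_eq_lp_set)

lemma lp_norm_triangle:
  assumes "1 \<le> p" "x \<in> carrier_vec n" "y \<in> carrier_vec n"
  shows "lp_norm p (x + y) \<le> lp_norm p x + lp_norm p y"
proof -
  have "lp_norm p (x + y) = lp_set p (\<lambda>i. x $ i + y $ i) {..<n}"
    unfolding lp_norm_eq_lp_set using assms by (intro lp_set_cong) auto
  then show ?thesis using assms lp_set_triangle[of "{..<n}" p "($) x" "($) y"]
    by (simp add: lp_norm_eq_lp_set)
qed

lemma lp_norm_le_add_diff:
  assumes "1 \<le> p" "x \<in> carrier_vec n" "y \<in> carrier_vec n"
  shows "lp_norm p x \<le> lp_norm p y + lp_norm p (x - y)"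
proof -
  have "x = y + (x - y)" using assms by (intro eq_vecI) auto
  then show ?thesis using lp_norm_triangle[OF assms(1), of y n "x - y"] assms by simp
qed

lemma lp_norm_diff_triangle:
  assumes "1 \<le> p" "x \<in> carrier_vec n" "y \<in> carrier_vec n" "z \<in> carrier_vec n"
  shows "lp_norm p (x - z) \<le> lp_norm p (x - y) + lp_norm p (y - z)"
proof -
  have "x - z = (x - y) + (y - z)" using assms by (intro eq_vecI) auto
  then show ?thesis using lp_norm_triangle[OF assms(1), of "x - y" n "y - z"] assms by simp
qed

text \<open>Entrywise bounds by a weighted sum carry over to norms. This form covers both an exact linear
  combination (\<open>k = 1\<close>) and its rounding error (\<open>k\<close> of order \<open>\<epsilon>\<close>).\<close>

lemma lp_norm_le_weighted_sum:
  assumes "1 \<le> p" "w \<in> carrier_vec N" "\<And>j. j \<in> J \<Longrightarrow> B j \<in> carrier_vec N" "0 \<le> k"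
    and bound: "\<And>c. c < N \<Longrightarrow> \<bar>w $ c\<bar> \<le> k * (\<Sum>j\<in>J. \<bar>a j\<bar> * \<bar>B j $ c\<bar>)"
  shows "lp_norm p w \<le> k * (\<Sum>j\<in>J. \<bar>a j\<bar> * lp_norm p (B j))"
proof -
  have dim: "dim_vec w = N" "\<And>j. j \<in> J \<Longrightarrow> dim_vec (B j) = N" using assms by auto
  have "lp_norm p w \<le> lp_set p (\<lambda>c. k * (\<Sum>j\<in>J. \<bar>a j\<bar> * \<bar>B j $ c\<bar>)) {..<N}"
    unfolding lp_norm_eq_lp_set dim(1)
    by (intro lp_set_mono assms) (use bound in \<open>auto intro: order_trans abs_ge_self\<close>)
  also have "\<dots> = k * lp_set p (\<lambda>c. \<Sum>j\<in>J. \<bar>a j\<bar> * \<bar>B j $ c\<bar>) {..<N}"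
    using assms by (simp add: lp_set_scale)
  also have "\<dots> \<le> k * (\<Sum>j\<in>J. lp_set p (\<lambda>c. \<bar>a j\<bar> * \<bar>B j $ c\<bar>) {..<N})"
    using assms by (intro mult_left_mono lp_set_sum) auto
  also have "(\<Sum>j\<in>J. lp_set p (\<lambda>c. \<bar>a j\<bar> * \<bar>B j $ c\<bar>) {..<N}) = (\<Sum>j\<in>J. \<bar>a j\<bar> * lp_norm p (B j))"
  proof (rule sum.cong[OF refl])
    fix j assume "j \<in> J"
    then have "lp_norm p (B j) = lp_set p (\<lambda>c. \<bar>B j $ c\<bar>) {..<N}"
      unfolding lp_norm_eq_lp_set dim(2)[OF \<open>j \<in> J\<close>] by (intro lp_set_cong) auto
    then show "lp_set p (\<lambda>c. \<bar>a j\<bar> * \<bar>B j $ c\<bar>) {..<N} = \<bar>a j\<bar> * lp_norm p (B j)"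
      using assms(1) by (simp add: lp_set_scale)
  qed
  finally show ?thesis .
qed

lemma lp_norm_lin_comb:
  assumes "1 \<le> p" "\<And>j. j < dim_vec a \<Longrightarrow> B j \<in> carrier_vec N"
  shows "lp_norm p (lin_comb N a B) \<le> (\<Sum>j<dim_vec a. \<bar>a $ j\<bar> * lp_norm p (B j))"
proof -
  have "lp_norm p (lin_comb N a B) \<le> 1 * (\<Sum>j<dim_vec a. \<bar>a $ j\<bar> * lp_norm p (B j))"
    by (rule lp_norm_le_weighted_sum[OF assms(1), of _ N])
      (use assms in \<open>auto simp: abs_mult[symmetric] intro: sum_abs\<close>)
  then show ?thesis by simp
qed

text \<open>The dual norm of the coefficients enters here: Hoelder's inequality is applied to the vector of the
  block norms, whose norm is that of \<open>u\<close>.\<close>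

lemma Hoelder_blocks:
  assumes "1 \<le> q" "u \<in> carrier_vec (dim_vec a * N)"
  shows "(\<Sum>j<dim_vec a. \<bar>a $ j\<bar> * lp_norm q (block N u j)) \<le> lp_norm (conj_exponent q) a * lp_norm q u"
proof -
  have "(\<Sum>j<dim_vec a. \<bar>a $ j\<bar> * \<bar>lp_norm q (block N u j)\<bar>)
      \<le> lp_norm (conj_exponent q) a * lp_set q (\<lambda>j. lp_norm q (block N u j)) {..<dim_vec a}"
    unfolding lp_norm_eq_lp_set[of "conj_exponent q"]
    by (rule Hoelder_lp_set) (use assms in auto)
  also have "lp_set q (\<lambda>j. lp_norm q (block N u j)) {..<dim_vec a} = lp_norm q u"
    using lp_norm_stack[OF assms(1), of "dim_vec a" "block N u" N] stack_block[OF assms(2)] by simp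
  finally show ?thesis by simp
qed

lemma lp_norm_lin_comb_block:
  assumes "1 \<le> q" "u \<in> carrier_vec (dim_vec a * N)"
  shows "lp_norm q (lin_comb N a (block N u)) \<le> lp_norm (conj_exponent q) a * lp_norm q u"
  using lp_norm_lin_comb[OF assms(1), of a "block N u" N] Hoelder_blocks[OF assms] by simp

section \<open>Rounding errors of linear combinations\<close>

lemma sum_mset_abs_nonneg: "0 \<le> (\<Sum>x\<in>#X. \<bar>x :: real\<bar>)"
  by (induction X) auto

text \<open>A sum of \<open>n\<close> terms performs \<open>n - 1\<close> additions, hence no term is rounded more than \<open>n - 1\<close> times,
  however the sum is parenthesized.\<close>

lemma fl_sum_error:
  assumes "fl_sum \<epsilon> X s" "0 \<le> \<epsilon>"
  shows "\<bar>s - sum_mset X\<bar> \<le> ((1 + \<epsilon>) ^ (size X - 1) - 1) * (\<Sum>x\<in>#X. \<bar>x\<bar>)"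
  using assms(1)
proof induction
  case (plus X Y x y z)
  obtain a b where ab: "size X = Suc a" "size Y = Suc b"
    using plus.hyps(1,2) by (metis nonempty_has_size gr0_implies_Suc)
  obtain \<delta> where \<delta>: "\<bar>\<delta>\<bar> \<le> \<epsilon>" "z = (x + y) * (1 + \<delta>)"
    using plus.hyps by (auto simp: rounds_to_def)
  have nn: "0 \<le> (\<Sum>x\<in>#X. \<bar>x\<bar>)" "0 \<le> (\<Sum>x\<in>#Y. \<bar>x\<bar>)"
    by (auto intro!: sum_mset_abs_nonneg)
  have abs_le: "\<bar>sum_mset Z\<bar> \<le> (\<Sum>x\<in>#Z. \<bar>x\<bar>)" for Z :: "real multiset"
    by (induction Z) auto
  have one: "(1 + \<epsilon>) * \<bar>w - sum_mset Z\<bar> + \<epsilon> * \<bar>sum_mset Z\<bar>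
      \<le> ((1 + \<epsilon>) ^ Suc (a + b) - 1) * (\<Sum>x\<in>#Z. \<bar>x\<bar>)"
    if "\<bar>w - sum_mset Z\<bar> \<le> ((1 + \<epsilon>) ^ k - 1) * (\<Sum>x\<in>#Z. \<bar>x\<bar>)" "k \<le> a + b" for w Z k
  proof -
    have "(1 + \<epsilon>) * \<bar>w - sum_mset Z\<bar> + \<epsilon> * \<bar>sum_mset Z\<bar>
        \<le> (1 + \<epsilon>) * (((1 + \<epsilon>) ^ k - 1) * (\<Sum>x\<in>#Z. \<bar>x\<bar>)) + \<epsilon> * (\<Sum>x\<in>#Z. \<bar>x\<bar>)"
      using that assms(2) abs_le by (intro add_mono mult_left_mono) auto
    also have "\<dots> = ((1 + \<epsilon>) ^ Suc k - 1) * (\<Sum>x\<in>#Z. \<bar>x\<bar>)"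
      by (simp only: power_Suc left_diff_distrib right_diff_distrib distrib_left distrib_right mult_1)
    also have "\<dots> \<le> ((1 + \<epsilon>) ^ Suc (a + b) - 1) * (\<Sum>x\<in>#Z. \<bar>x\<bar>)"
      using that assms(2)
      by (intro mult_right_mono diff_right_mono power_increasing) (auto intro!: sum_mset_abs_nonneg)
    finally show ?thesis .
  qed
  have split: "z - sum_mset (X + Y) = (1 + \<delta>) * (x - sum_mset X) + \<delta> * sum_mset X
      + ((1 + \<delta>) * (y - sum_mset Y) + \<delta> * sum_mset Y)"
    unfolding sum_mset.union \<delta>(2)
    by (simp only: left_diff_distrib right_diff_distrib distrib_left distrib_right mult_1 mult_1_right mult.commute)
  have one_term: "\<bar>(1 + \<delta>) * w + \<delta> * w'\<bar> \<le> (1 + \<epsilon>) * \<bar>w\<bar> + \<epsilon> * \<bar>w'\<bar>" for w w'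
  proof -
    have "\<bar>(1 + \<delta>) * w + \<delta> * w'\<bar> \<le> \<bar>1 + \<delta>\<bar> * \<bar>w\<bar> + \<bar>\<delta>\<bar> * \<bar>w'\<bar>"
      using abs_triangle_ineq[of "(1 + \<delta>) * w" "\<delta> * w'"] by (simp only: abs_mult)
    also have "\<dots> \<le> (1 + \<epsilon>) * \<bar>w\<bar> + \<epsilon> * \<bar>w'\<bar>"
      using \<delta>(1) by (intro add_mono mult_right_mono) auto
    finally show ?thesis .
  qed
  have "\<bar>z - sum_mset (X + Y)\<bar> \<le>
      (1 + \<epsilon>) * \<bar>x - sum_mset X\<bar> + \<epsilon> * \<bar>sum_mset X\<bar>
      + ((1 + \<epsilon>) * \<bar>y - sum_mset Y\<bar> + \<epsilon> * \<bar>sum_mset Y\<bar>)"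
    unfolding split by (rule order_trans[OF abs_triangle_ineq add_mono[OF one_term one_term]])
  also have "\<dots> \<le> ((1 + \<epsilon>) ^ Suc (a + b) - 1) * (\<Sum>x\<in>#X. \<bar>x\<bar>)
      + ((1 + \<epsilon>) ^ Suc (a + b) - 1) * (\<Sum>x\<in>#Y. \<bar>x\<bar>)"
    using plus.IH by (intro add_mono[OF one[of x X a] one[of y Y b]]) (simp_all only: ab diff_Suc_1 le_add1 le_add2)
  also have "\<dots> = ((1 + \<epsilon>) ^ Suc (a + b) - 1) * (\<Sum>x\<in>#X + Y. \<bar>x\<bar>)"
    by (simp only: image_mset_union sum_mset.union distrib_left)
  finally show ?case by (simp add: ab)
qed auto

text \<open>The product adds one rounding to each term, so the exponent is the full number of nonzero
  coefficients; with no nonzero coefficient the result \<open>0\<close> is exact.\<close>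

lemma fl_dot_error:
  assumes "fl_dot \<epsilon> a x s" "0 \<le> \<epsilon>"
  shows "\<bar>s - (\<Sum>j<dim_vec a. a $ j * x j)\<bar>
    \<le> ((1 + \<epsilon>) ^ nnz a - 1) * (\<Sum>j<dim_vec a. \<bar>a $ j\<bar> * \<bar>x j\<bar>)"
proof -
  define J where "J = {j. j < dim_vec a \<and> a $ j \<noteq> 0}"
  have fin: "finite J" by (simp add: J_def)
  obtain t where t: "\<And>j. j \<in> J \<Longrightarrow> rounds_to \<epsilon> (a $ j * x j) (t j)"
    and s: "fl_sum \<epsilon> (image_mset t (mset_set J)) s"
    using assms(1) by (auto simp: fl_dot_def J_def)
  have on_J: "(\<Sum>j<dim_vec a. h (a $ j) (x j)) = (\<Sum>j\<in>J. h (a $ j) (x j))"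
    if "\<And>y. h 0 y = 0" for h :: "real \<Rightarrow> real \<Rightarrow> real"
    by (rule sum.mono_neutral_right) (auto simp: J_def that)
  let ?S = "\<Sum>j\<in>J. \<bar>a $ j\<bar> * \<bar>x j\<bar>"
  have nn: "0 \<le> ?S" by (simp add: sum_nonneg)
  have tj: "\<bar>t j - a $ j * x j\<bar> \<le> \<epsilon> * (\<bar>a $ j\<bar> * \<bar>x j\<bar>)" if j: "j \<in> J" for j
  proof -
    obtain \<delta> where \<delta>: "\<bar>\<delta>\<bar> \<le> \<epsilon>" "t j = a $ j * x j * (1 + \<delta>)"
      using t[OF j] by (auto simp: rounds_to_def)
    have "t j - a $ j * x j = \<delta> * (a $ j * x j)" by (simp add: \<delta>(2) algebra_simps)
    then show ?thesis using \<delta>(1) by (simp add: abs_mult mult_right_mono)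
  qed
  have "\<bar>(\<Sum>j\<in>J. t j) - (\<Sum>j\<in>J. a $ j * x j)\<bar> \<le> (\<Sum>j\<in>J. \<bar>t j - a $ j * x j\<bar>)"
    by (simp flip: sum_subtractf)
  also have "\<dots> \<le> \<epsilon> * ?S" using tj by (simp add: sum_distrib_left sum_mono)
  finally have err_t: "\<bar>(\<Sum>j\<in>J. t j) - (\<Sum>j\<in>J. a $ j * x j)\<bar> \<le> \<epsilon> * ?S" .
  have "\<bar>t j\<bar> \<le> (1 + \<epsilon>) * (\<bar>a $ j\<bar> * \<bar>x j\<bar>)" if "j \<in> J" for j
  proof -
    have "\<bar>t j\<bar> \<le> \<bar>a $ j * x j\<bar> + \<bar>t j - a $ j * x j\<bar>" by linarith
    then show ?thesis using tj[OF that] by (simp add: abs_mult algebra_simps)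
  qed
  then have abs_t: "(\<Sum>j\<in>J. \<bar>t j\<bar>) \<le> (1 + \<epsilon>) * ?S"
    by (simp add: sum_distrib_left sum_mono)
  have err_s: "\<bar>s - (\<Sum>j\<in>J. t j)\<bar> \<le> ((1 + \<epsilon>) ^ (card J - 1) - 1) * (\<Sum>j\<in>J. \<bar>t j\<bar>)"
    using fl_sum_error[OF s assms(2)] by (simp add: image_mset.compositionality comp_def sum_unfold_sum_mset)
  have "\<bar>s - (\<Sum>j\<in>J. a $ j * x j)\<bar> \<le> ((1 + \<epsilon>) ^ card J - 1) * ?S"
  proof (cases "J = {}")
    case True
    then show ?thesis using err_s by simp
  next
    case False
    then obtain n where n: "card J = Suc n" using fin by (metis card_gt_0_iff gr0_implies_Suc)
    have "\<bar>s - (\<Sum>j\<in>J. a $ j * x j)\<bar> \<le> ((1 + \<epsilon>) ^ n - 1) * (\<Sum>j\<in>J. \<bar>t j\<bar>) + \<epsilon> * ?S"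
      using err_s err_t by (simp add: n)
    also have "\<dots> \<le> ((1 + \<epsilon>) ^ n - 1) * ((1 + \<epsilon>) * ?S) + \<epsilon> * ?S"
      using abs_t assms(2) by (intro add_right_mono mult_left_mono) auto
    also have "\<dots> = ((1 + \<epsilon>) ^ card J - 1) * ?S" by (simp add: n algebra_simps)
    finally show ?thesis .
  qed
  then show ?thesis
    using on_J[of "\<lambda>a x. a * x"] on_J[of "\<lambda>a x. \<bar>a\<bar> * \<bar>x\<bar>"] by (simp add: nnz_def J_def)
qed

lemma fl_lin_comb_error:
  assumes "1 \<le> p" "0 \<le> \<epsilon>" "fl_lin_comb \<epsilon> N a B w" "\<And>j. j < dim_vec a \<Longrightarrow> B j \<in> carrier_vec N"
  shows "lp_norm p (w - lin_comb N a B)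
    \<le> ((1 + \<epsilon>) ^ nnz a - 1) * (\<Sum>j<dim_vec a. \<bar>a $ j\<bar> * lp_norm p (B j))"
proof (rule lp_norm_le_weighted_sum[OF assms(1)])
  show "\<bar>(w - lin_comb N a B) $ c\<bar>
      \<le> ((1 + \<epsilon>) ^ nnz a - 1) * (\<Sum>j<dim_vec a. \<bar>a $ j\<bar> * \<bar>B j $ c\<bar>)" if "c < N" for c
    using fl_dot_error[of \<epsilon> a "\<lambda>j. B j $ c" "w $ c"] assms(2,3) that
    by (simp add: fl_lin_comb_def)
  have "w \<in> carrier_vec N" using assms(3) by (simp add: fl_lin_comb_def)
  then show "w - lin_comb N a B \<in> carrier_vec N" by simp
  show "0 \<le> (1 + \<epsilon>) ^ nnz a - 1" using assms(2) by simp
qed (use assms(4) in auto)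

section \<open>One level of the recursion\<close>

text \<open>The passage from a bilinear map \<open>b\<close> on blocks of lengths \<open>M\<close>, \<open>N\<close>, \<open>K\<close> to the next level. The recursion
  consists of such steps, and all estimates are made for a single step with an arbitrary \<open>b\<close>.\<close>

definition bilin_step ::
    "real mat \<Rightarrow> real mat \<Rightarrow> real mat \<Rightarrow> nat \<Rightarrow> nat \<Rightarrow> nat \<Rightarrow>
     (real vec \<Rightarrow> real vec \<Rightarrow> real vec) \<Rightarrow> real vec \<Rightarrow> real vec \<Rightarrow> real vec" where
  "bilin_step L R P M N K b u v =
     stack (dim_row P) K (\<lambda>J. lin_comb K (row P J)
       (\<lambda>i. b (lin_comb M (row L i) (block M u)) (lin_comb N (row R i) (block N v))))"

definition fl_bilin_step ::
    "real mat \<Rightarrow> real mat \<Rightarrow> real mat \<Rightarrow> nat \<Rightarrow> nat \<Rightarrow> nat \<Rightarrow> fl_bilinear \<Rightarrow> fl_bilinear" where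
  "fl_bilin_step L R P M N K A = (\<lambda>\<epsilon> u v w.
     \<exists>x y z W.
       (\<forall>i<dim_col P.
          fl_lin_comb \<epsilon> M (row L i) (block M u) (x i) \<and>
          fl_lin_comb \<epsilon> N (row R i) (block N v) (y i) \<and>
          A \<epsilon> (x i) (y i) (z i)) \<and>
       (\<forall>J<dim_row P. fl_lin_comb \<epsilon> K (row P J) z (W J)) \<and>
       w = stack (dim_row P) K W)"

lemma bilin_pow_Suc:
  "bilin_pow L R P e0 f0 g0 \<beta>0 (Suc l) =
     bilin_step L R P (e0 * dim_col L ^ l) (f0 * dim_col R ^ l) (g0 * dim_row P ^ l)
       (bilin_pow L R P e0 f0 g0 \<beta>0 l)"
  by (intro ext) (simp add: bilin_step_def Let_def)

lemma fl_bilin_pow_Suc: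
  "fl_bilin_pow L R P e0 f0 g0 A0 (Suc l) =
     fl_bilin_step L R P (e0 * dim_col L ^ l) (f0 * dim_col R ^ l) (g0 * dim_row P ^ l)
       (fl_bilin_pow L R P e0 f0 g0 A0 l)"
  by (intro ext) (simp add: fl_bilin_step_def Let_def)

lemma fl_algorithm_carrier:
  assumes "fl_algorithm e f g A" "0 < \<epsilon>" "u \<in> carrier_vec e" "v \<in> carrier_vec f" "A \<epsilon> u v w"
  shows "w \<in> carrier_vec g"
  using assms by (simp add: fl_algorithm_def)

lemma bilinear_map_diff:
  assumes "bilinear_map M N K b"
    and "x \<in> carrier_vec M" "x' \<in> carrier_vec M" "y \<in> carrier_vec N" "y' \<in> carrier_vec N"
  shows "b x y - b x' y' = b (x - x') y + b x' (y - y')"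
proof -
  have x: "x = x' + (x - x')" and y: "y = y' + (y - y')"
    using assms by (auto intro!: eq_vecI)
  have carr: "b s t \<in> carrier_vec K" if "s \<in> carrier_vec M" "t \<in> carrier_vec N" for s t
    using assms that by (simp add: bilinear_map_def)
  have "b x y = b x' y + b (x - x') y"
    by (subst x) (use assms in \<open>simp add: bilinear_map_def\<close>)
  moreover have "b x' y = b x' y' + b x' (y - y')"
    by (subst y) (use assms in \<open>simp add: bilinear_map_def\<close>)
  ultimately show ?thesis
    using carr[of x' y'] carr[of "x - x'" y] carr[of x' "y - y'"] assms by (auto intro!: eq_vecI)
qed

locale recursion_step =
  fixes L R P :: "real mat" and e f g r M N K :: nat
    and b :: "real vec \<Rightarrow> real vec \<Rightarrow> real vec"
  assumes L: "L \<in> carrier_mat r e" and R: "R \<in> carrier_mat r f" and P: "P \<in> carrier_mat g r"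
    and bilinear: "bilinear_map M N K b"
begin

lemma dims [simp]:
  "dim_row L = r" "dim_col L = e" "dim_row R = r" "dim_col R = f" "dim_row P = g" "dim_col P = r"
  using L R P by auto

lemma b_carrier [simp]: "u \<in> carrier_vec M \<Longrightarrow> v \<in> carrier_vec N \<Longrightarrow> b u v \<in> carrier_vec K"
  using bilinear by (simp add: bilinear_map_def)

lemma bilinear_map_step: "bilinear_map (e * M) (f * N) (g * K) (bilin_step L R P M N K b)"
proof -
  have addL: "lin_comb M (row L i) (block M (u + u'))
      = lin_comb M (row L i) (block M u) + lin_comb M (row L i) (block M u')"
    if "u \<in> carrier_vec (e * M)" "u' \<in> carrier_vec (e * M)" for u u' i
    using that by (subst lin_comb_add[symmetric]) (auto intro!: lin_comb_cong block_add)
  have addR: "lin_comb N (row R i) (block N (v + v'))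
      = lin_comb N (row R i) (block N v) + lin_comb N (row R i) (block N v')"
    if "v \<in> carrier_vec (f * N)" "v' \<in> carrier_vec (f * N)" for v v' i
    using that by (subst lin_comb_add[symmetric]) (auto intro!: lin_comb_cong block_add)
  have smultL: "lin_comb M (row L i) (block M (k \<cdot>\<^sub>v u)) = k \<cdot>\<^sub>v lin_comb M (row L i) (block M u)"
    if "u \<in> carrier_vec (e * M)" for u k i
    using that by (subst lin_comb_smult[symmetric]) (auto intro!: lin_comb_cong block_smult)
  have smultR: "lin_comb N (row R i) (block N (k \<cdot>\<^sub>v v)) = k \<cdot>\<^sub>v lin_comb N (row R i) (block N v)"
    if "v \<in> carrier_vec (f * N)" for v k i
    using that by (subst lin_comb_smult[symmetric]) (auto intro!: lin_comb_cong block_smult)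
  show ?thesis
    unfolding bilinear_map_def
  proof (intro conjI ballI allI)
    fix u v :: "real vec" assume u: "u \<in> carrier_vec (e * M)" and v: "v \<in> carrier_vec (f * N)"
    show "bilin_step L R P M N K b u v \<in> carrier_vec (g * K)" by (simp add: bilin_step_def)
    show "bilin_step L R P M N K b (u + u') v
        = bilin_step L R P M N K b u v + bilin_step L R P M N K b u' v"
      if "u' \<in> carrier_vec (e * M)" for u'
      using u v that bilinear unfolding bilin_step_def addL[OF u that] bilinear_map_def
      by (simp add: lin_comb_add stack_add)
    show "bilin_step L R P M N K b u (v + v')
        = bilin_step L R P M N K b u v + bilin_step L R P M N K b u v'"
      if "v' \<in> carrier_vec (f * N)" for v'
      using u v that bilinear unfolding bilin_step_def addR[OF v that] bilinear_map_def
      by (simp add: lin_comb_add stack_add)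
    fix k
    show "bilin_step L R P M N K b (k \<cdot>\<^sub>v u) v = k \<cdot>\<^sub>v bilin_step L R P M N K b u v"
      using u v bilinear unfolding bilin_step_def smultL[OF u] bilinear_map_def
      by (simp add: lin_comb_smult stack_smult)
    show "bilin_step L R P M N K b u (k \<cdot>\<^sub>v v) = k \<cdot>\<^sub>v bilin_step L R P M N K b u v"
      using u v bilinear unfolding bilin_step_def smultR[OF v] bilinear_map_def
      by (simp add: lin_comb_smult stack_smult)
  qed
qed

abbreviation row_norms :: "ereal \<Rightarrow> nat \<Rightarrow> real" where
  "row_norms q i \<equiv> lp_norm (conj_exponent q) (row L i) * lp_norm (conj_exponent q) (row R i)"

lemma growth_factor_eq:
  "growth_factor p q L R P = lp_set p (\<lambda>J. \<Sum>i<r. \<bar>P $$ (J, i)\<bar> * row_norms q i) {..<g}"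
  unfolding growth_factor_def lp_norm_eq_lp_set
  by (intro lp_set_cong) (auto simp: ac_simps intro!: arg_cong[of _ _ abs] sum.cong)

lemma norm_product_le:
  assumes "1 \<le> q" and u: "u \<in> carrier_vec (e * M)" and v: "v \<in> carrier_vec (f * N)"
    and G: "0 \<le> G" "\<And>u v. u \<in> carrier_vec M \<Longrightarrow> v \<in> carrier_vec N \<Longrightarrow>
      lp_norm p (b u v) \<le> G * lp_norm q u * lp_norm q v"
  shows "lp_norm p (b (lin_comb M (row L i) (block M u)) (lin_comb N (row R i) (block N v)))
    \<le> G * row_norms q i * (lp_norm q u * lp_norm q v)"
proof -
  have "lp_norm q (lin_comb M (row L i) (block M u)) \<le> lp_norm (conj_exponent q) (row L i) * lp_norm q u"
    "lp_norm q (lin_comb N (row R i) (block N v)) \<le> lp_norm (conj_exponent q) (row R i) * lp_norm q v"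
    using assms by (intro lp_norm_lin_comb_block; simp)+
  then have "G * (lp_norm q (lin_comb M (row L i) (block M u))
      * lp_norm q (lin_comb N (row R i) (block N v)))
    \<le> G * ((lp_norm (conj_exponent q) (row L i) * lp_norm q u)
      * (lp_norm (conj_exponent q) (row R i) * lp_norm q v))"
    using G(1) by (intro mult_left_mono mult_mono) auto
  then show ?thesis
    using G(2)[of "lin_comb M (row L i) (block M u)" "lin_comb N (row R i) (block N v)"]
    by (simp add: ac_simps)
qed

lemma norm_step_le:
  assumes "1 \<le> p" "1 \<le> q" and u: "u \<in> carrier_vec (e * M)" and v: "v \<in> carrier_vec (f * N)"
    and G: "0 \<le> G" "\<And>u v. u \<in> carrier_vec M \<Longrightarrow> v \<in> carrier_vec N \<Longrightarrow>
      lp_norm p (b u v) \<le> G * lp_norm q u * lp_norm q v"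
  shows "lp_norm p (bilin_step L R P M N K b u v)
    \<le> G * growth_factor p q L R P * lp_norm q u * lp_norm q v"
proof -
  let ?B = "\<lambda>i. b (lin_comb M (row L i) (block M u)) (lin_comb N (row R i) (block N v))"
  let ?T = "\<lambda>J. \<Sum>i<r. \<bar>P $$ (J, i)\<bar> * row_norms q i"
  define c where "c = G * (lp_norm q u * lp_norm q v)"
  have c: "0 \<le> c" using G by (simp add: c_def)
  have "lp_norm p (lin_comb K (row P J) ?B) \<le> c * ?T J" if "J < g" for J
  proof -
    have "lp_norm p (lin_comb K (row P J) ?B) \<le> (\<Sum>i<r. \<bar>P $$ (J, i)\<bar> * lp_norm p (?B i))"
      using lp_norm_lin_comb[OF assms(1), of "row P J" ?B K] that by simp
    also have "\<dots> \<le> (\<Sum>i<r. \<bar>P $$ (J, i)\<bar> * (G * row_norms q i * (lp_norm q u * lp_norm q v)))"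
      using assms by (intro sum_mono mult_left_mono norm_product_le) auto
    also have "\<dots> = c * ?T J" by (simp add: c_def sum_distrib_left ac_simps)
    finally show ?thesis .
  qed
  then have "lp_set p (\<lambda>J. lp_norm p (lin_comb K (row P J) ?B)) {..<g} \<le> lp_set p (\<lambda>J. c * ?T J) {..<g}"
    using assms by (intro lp_set_mono) (auto intro: order_trans[OF _ abs_ge_self])
  also have "\<dots> = c * growth_factor p q L R P"
    using c assms by (simp add: lp_set_scale growth_factor_eq)
  finally show ?thesis
    using assms(1) by (simp add: bilin_step_def lp_norm_stack c_def ac_simps)
qed

end

section \<open>The error of one level\<close>

context recursion_step
begin

text \<open>The estimate for a fixed precision, with all higher order terms kept in the powers of \<open>1 + \<epsilon>\<close>. The
  error of the recursive calls is assumed only for the inputs that can occur, since their second order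
  term is uniform only over bounded sets.\<close>

lemma step_error:
  assumes "1 \<le> p" "1 \<le> q" and u: "u \<in> carrier_vec (e * M)" and v: "v \<in> carrier_vec (f * N)"
    and G: "0 \<le> G" "\<And>u v. u \<in> carrier_vec M \<Longrightarrow> v \<in> carrier_vec N \<Longrightarrow>
      lp_norm p (b u v) \<le> G * lp_norm q u * lp_norm q v"
    and nn: "0 \<le> F" "0 \<le> C" "0 \<le> \<epsilon>"
    and Q: "\<And>J i. J < g \<Longrightarrow> i < r \<Longrightarrow> P $$ (J, i) \<noteq> 0 \<Longrightarrow>
      nnz (row P J) + (nnz (row L i) + nnz (row R i)) \<le> Q"
    and A: "\<And>i x y z. i < r \<Longrightarrow> x \<in> carrier_vec M \<Longrightarrow> y \<in> carrier_vec N \<Longrightarrow>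
      lp_norm q x \<le> (1 + \<epsilon>) ^ nnz (row L i) * (lp_norm (conj_exponent q) (row L i) * lp_norm q u) \<Longrightarrow>
      lp_norm q y \<le> (1 + \<epsilon>) ^ nnz (row R i) * (lp_norm (conj_exponent q) (row R i) * lp_norm q v) \<Longrightarrow>
      A \<epsilon> x y z \<Longrightarrow>
      z \<in> carrier_vec K \<and> lp_norm p (z - b x y) \<le> F * lp_norm q x * lp_norm q y * \<epsilon> + C * \<epsilon>\<^sup>2"
    and step: "fl_bilin_step L R P M N K A \<epsilon> u v w"
  shows "lp_norm p (w - bilin_step L R P M N K b u v)
    \<le> growth_factor p q L R P * (F * \<epsilon> * (1 + \<epsilon>) ^ Q + G * ((1 + \<epsilon>) ^ Q - 1))
        * (lp_norm q u * lp_norm q v)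
      + C * \<epsilon>\<^sup>2 * (1 + \<epsilon>) ^ Q * lp_set p (\<lambda>J. \<Sum>i<r. \<bar>P $$ (J, i)\<bar>) {..<g}"
proof -
  obtain x y z W
    where x: "\<And>i. i < r \<Longrightarrow> fl_lin_comb \<epsilon> M (row L i) (block M u) (x i)"
      and y: "\<And>i. i < r \<Longrightarrow> fl_lin_comb \<epsilon> N (row R i) (block N v) (y i)"
      and z: "\<And>i. i < r \<Longrightarrow> A \<epsilon> (x i) (y i) (z i)"
      and W: "\<And>J. J < g \<Longrightarrow> fl_lin_comb \<epsilon> K (row P J) z (W J)"
      and w: "w = stack g K W"
    using step unfolding fl_bilin_step_def dims by blast
  define X where "X = (\<lambda>i. lin_comb M (row L i) (block M u))"
  define Y where "Y = (\<lambda>i. lin_comb N (row R i) (block N v))"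
  define h where "h = 1 + \<epsilon>"
  define a where "a = (\<lambda>i. lp_norm (conj_exponent q) (row L i) * lp_norm q u)"
  define c where "c = (\<lambda>i. lp_norm (conj_exponent q) (row R i) * lp_norm q v)"
  define s where "s = (\<lambda>i. nnz (row L i) + nnz (row R i))"
  have h: "1 \<le> h" using nn by (simp add: h_def)
  have hn: "0 \<le> h ^ n - 1" "0 \<le> h ^ n" for n using h by (auto simp: one_le_power)
  have ac: "0 \<le> a i" "0 \<le> c i" for i by (simp_all add: a_def c_def)
  have XY: "X i \<in> carrier_vec M" "Y i \<in> carrier_vec N" for i by (simp_all add: X_def Y_def)
  have xy: "x i \<in> carrier_vec M" "y i \<in> carrier_vec N" if "i < r" for i
    using x[OF that] y[OF that] by (simp_all add: fl_lin_comb_def)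
  have Xn: "lp_norm q (X i) \<le> a i" and Yn: "lp_norm q (Y i) \<le> c i" for i
    using assms unfolding X_def Y_def a_def c_def by (intro lp_norm_lin_comb_block; simp)+
  have dx: "lp_norm q (x i - X i) \<le> (h ^ nnz (row L i) - 1) * a i" if "i < r" for i
  proof -
    have "lp_norm q (x i - X i)
        \<le> (h ^ nnz (row L i) - 1) * (\<Sum>j<dim_vec (row L i). \<bar>row L i $ j\<bar> * lp_norm q (block M u j))"
      unfolding X_def h_def using assms(2) nn x[OF that] by (intro fl_lin_comb_error) auto
    also have "\<dots> \<le> (h ^ nnz (row L i) - 1) * a i"
      unfolding a_def using assms(2) u hn by (intro mult_left_mono Hoelder_blocks) auto
    finally show ?thesis .
  qed
  have dy: "lp_norm q (y i - Y i) \<le> (h ^ nnz (row R i) - 1) * c i" if "i < r" for i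
  proof -
    have "lp_norm q (y i - Y i)
        \<le> (h ^ nnz (row R i) - 1) * (\<Sum>j<dim_vec (row R i). \<bar>row R i $ j\<bar> * lp_norm q (block N v j))"
      unfolding Y_def h_def using assms(2) nn y[OF that] by (intro fl_lin_comb_error) auto
    also have "\<dots> \<le> (h ^ nnz (row R i) - 1) * c i"
      unfolding c_def using assms(2) v hn by (intro mult_left_mono Hoelder_blocks) auto
    finally show ?thesis .
  qed
  have xn: "lp_norm q (x i) \<le> h ^ nnz (row L i) * a i" if "i < r" for i
    using lp_norm_le_add_diff[OF assms(2) xy(1)[OF that] XY(1)[of i]] dx[OF that] Xn[of i]
    by (simp add: algebra_simps)
  have yn: "lp_norm q (y i) \<le> h ^ nnz (row R i) * c i" if "i < r" for i
    using lp_norm_le_add_diff[OF assms(2) xy(2)[OF that] XY(2)[of i]] dy[OF that] Yn[of i]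
    by (simp add: algebra_simps)
  have zA: "z i \<in> carrier_vec K"
    "lp_norm p (z i - b (x i) (y i)) \<le> F * lp_norm q (x i) * lp_norm q (y i) * \<epsilon> + C * \<epsilon>\<^sup>2"
    if "i < r" for i
    using A[OF that xy[OF that] _ _ z[OF that]] xn[OF that] yn[OF that]
    by (auto simp: h_def a_def c_def)
  \<comment> \<open>\<open>D i\<close> bounds the error of the \<open>i\<close>-th product: the recursive call on perturbed inputs, and the
    effect of the perturbation on the exact map.\<close>
  define D where "D = (\<lambda>i. (F * \<epsilon> * h ^ s i + G * (h ^ s i - 1)) * (a i * c i) + C * \<epsilon>\<^sup>2)"
  have dz: "lp_norm p (z i - b (X i) (Y i)) \<le> D i" if i: "i < r" for i
  proof -
    have "lp_norm p (z i - b (x i) (y i)) \<le> F * (lp_norm q (x i) * lp_norm q (y i)) * \<epsilon> + C * \<epsilon>\<^sup>2"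
      using zA(2)[OF i] by (simp add: ac_simps)
    also have "\<dots> \<le> F * ((h ^ nnz (row L i) * a i) * (h ^ nnz (row R i) * c i)) * \<epsilon> + C * \<epsilon>\<^sup>2"
      using xn[OF i] yn[OF i] nn hn ac
      by (intro add_right_mono mult_right_mono mult_left_mono mult_mono) auto
    also have "\<dots> = F * \<epsilon> * h ^ s i * (a i * c i) + C * \<epsilon>\<^sup>2"
      by (simp add: s_def power_add)
    finally have 1: "lp_norm p (z i - b (x i) (y i)) \<le> F * \<epsilon> * h ^ s i * (a i * c i) + C * \<epsilon>\<^sup>2" .
    have "lp_norm p (b (x i) (y i) - b (X i) (Y i))
        \<le> lp_norm p (b (x i - X i) (y i)) + lp_norm p (b (X i) (y i - Y i))"
      unfolding bilinear_map_diff[OF bilinear xy(1)[OF i] XY(1)[of i] xy(2)[OF i] XY(2)[of i]]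
      using xy[OF i] XY[of i] by (intro lp_norm_triangle[OF assms(1), of _ K]) auto
    also have "\<dots> \<le> G * (lp_norm q (x i - X i) * lp_norm q (y i))
        + G * (lp_norm q (X i) * lp_norm q (y i - Y i))"
      using G(2)[of "x i - X i" "y i"] G(2)[of "X i" "y i - Y i"] xy[OF i] XY[of i]
      by (simp add: mult.assoc)
    also have "\<dots> \<le> G * (((h ^ nnz (row L i) - 1) * a i) * (h ^ nnz (row R i) * c i))
        + G * (a i * ((h ^ nnz (row R i) - 1) * c i))"
      using dx[OF i] dy[OF i] Xn[of i] yn[OF i] G(1) hn ac
      by (intro add_mono mult_left_mono mult_mono) auto
    also have "\<dots> = G * (h ^ s i - 1) * (a i * c i)"
      by (simp add: s_def power_add algebra_simps)
    finally have 2: "lp_norm p (b (x i) (y i) - b (X i) (Y i)) \<le> G * (h ^ s i - 1) * (a i * c i)" .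
    have "lp_norm p (z i - b (X i) (Y i))
        \<le> lp_norm p (z i - b (x i) (y i)) + lp_norm p (b (x i) (y i) - b (X i) (Y i))"
      using zA(1)[OF i] xy[OF i] XY[of i] by (intro lp_norm_diff_triangle[OF assms(1), of _ K]) auto
    with 1 2 show ?thesis by (simp add: D_def algebra_simps)
  qed
  have Zn: "lp_norm p (b (X i) (Y i)) \<le> G * (a i * c i)" for i
    using norm_product_le[OF assms(2) u v G, of i]
    by (simp add: X_def Y_def a_def c_def ac_simps)
  have zn: "lp_norm p (z i) \<le> G * (a i * c i) + D i" if i: "i < r" for i
    using lp_norm_le_add_diff[OF assms(1) zA(1)[OF i] b_carrier[OF XY, of i i]] dz[OF i] Zn[of i]
    by simp
  define T where "T = (\<lambda>J. \<Sum>i<r. \<bar>P $$ (J, i)\<bar> * row_norms q i)"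
  define S where "S = (\<lambda>J. \<Sum>i<r. \<bar>P $$ (J, i)\<bar>)"
  define \<kappa> where "\<kappa> = (F * \<epsilon> * h ^ Q + G * (h ^ Q - 1)) * (lp_norm q u * lp_norm q v)"
  define \<mu> where "\<mu> = C * \<epsilon>\<^sup>2 * h ^ Q"
  have pos: "0 \<le> \<kappa>" "0 \<le> \<mu>" using nn G(1) hn by (simp_all add: \<kappa>_def \<mu>_def)
  \<comment> \<open>The roundings in row \<open>J\<close> of \<open>P\<close> contribute \<open>h ^ k\<close>; where \<open>P $$ (J, i)\<close> is nonzero, the combined
    exponent \<open>k + s i\<close> is at most \<open>Q\<close>.\<close>
  have dW: "lp_norm p (W J - lin_comb K (row P J) (\<lambda>i. b (X i) (Y i))) \<le> \<kappa> * T J + \<mu> * S J"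
    if J: "J < g" for J
  proof -
    define k where "k = nnz (row P J)"
    have PJ: "dim_vec (row P J) = r" "row P J $ i = P $$ (J, i)" if "i < r" for i
      using that J by auto
    have "lp_norm p (W J - lin_comb K (row P J) (\<lambda>i. b (X i) (Y i)))
        \<le> lp_norm p (W J - lin_comb K (row P J) z)
          + lp_norm p (lin_comb K (row P J) z - lin_comb K (row P J) (\<lambda>i. b (X i) (Y i)))"
      using W[OF J] by (intro lp_norm_diff_triangle[OF assms(1), of _ K]) (auto simp: fl_lin_comb_def)
    also have "\<dots> \<le> (h ^ k - 1) * (\<Sum>i<r. \<bar>P $$ (J, i)\<bar> * lp_norm p (z i))
        + (\<Sum>i<r. \<bar>P $$ (J, i)\<bar> * lp_norm p (z i - b (X i) (Y i)))"
    proof (rule add_mono)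
      show "lp_norm p (W J - lin_comb K (row P J) z)
          \<le> (h ^ k - 1) * (\<Sum>i<r. \<bar>P $$ (J, i)\<bar> * lp_norm p (z i))"
        using fl_lin_comb_error[OF assms(1) nn(3) W[OF J]] zA(1) J by (simp add: h_def k_def)
      have "lin_comb K (row P J) z - lin_comb K (row P J) (\<lambda>i. b (X i) (Y i))
          = lin_comb K (row P J) (\<lambda>i. z i - b (X i) (Y i))"
        using XY by (intro lin_comb_diff) auto
      then show "lp_norm p (lin_comb K (row P J) z - lin_comb K (row P J) (\<lambda>i. b (X i) (Y i)))
          \<le> (\<Sum>i<r. \<bar>P $$ (J, i)\<bar> * lp_norm p (z i - b (X i) (Y i)))"
        using lp_norm_lin_comb[OF assms(1), of "row P J" "\<lambda>i. z i - b (X i) (Y i)" K]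
          minus_carrier_vec[OF zA(1) b_carrier[OF XY]] J by simp
    qed
    also have "\<dots> \<le> (h ^ k - 1) * (\<Sum>i<r. \<bar>P $$ (J, i)\<bar> * (G * (a i * c i) + D i))
        + (\<Sum>i<r. \<bar>P $$ (J, i)\<bar> * D i)"
      using zn dz hn by (intro add_mono mult_left_mono sum_mono) auto
    also have "\<dots> = (\<Sum>i<r. \<bar>P $$ (J, i)\<bar> * ((h ^ k - 1) * (G * (a i * c i)) + h ^ k * D i))"
      by (simp add: sum_distrib_left algebra_simps flip: sum.distrib sum_subtractf)
    also have "\<dots> \<le> (\<Sum>i<r. \<bar>P $$ (J, i)\<bar> *
        ((F * \<epsilon> * h ^ Q + G * (h ^ Q - 1)) * (a i * c i) + \<mu>))"
    proof (rule sum_mono)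
      fix i assume i: "i \<in> {..<r}"
      show "\<bar>P $$ (J, i)\<bar> * ((h ^ k - 1) * (G * (a i * c i)) + h ^ k * D i)
          \<le> \<bar>P $$ (J, i)\<bar> * ((F * \<epsilon> * h ^ Q + G * (h ^ Q - 1)) * (a i * c i) + \<mu>)"
      proof (cases "P $$ (J, i) = 0")
        case False
        then have "k + s i \<le> Q" "k \<le> Q" using Q[OF J, of i] i by (simp_all add: k_def s_def)
        then have pw: "h ^ (k + s i) \<le> h ^ Q" "h ^ k \<le> h ^ Q"
          using h by (intro power_increasing; simp)+
        have "(h ^ k - 1) * (G * (a i * c i)) + h ^ k * D i
            = (F * \<epsilon> * h ^ (k + s i) + G * (h ^ (k + s i) - 1)) * (a i * c i) + C * \<epsilon>\<^sup>2 * h ^ k"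
          by (simp add: D_def power_add algebra_simps)
        also have "\<dots> \<le> (F * \<epsilon> * h ^ Q + G * (h ^ Q - 1)) * (a i * c i) + \<mu>"
          unfolding \<mu>_def using pw nn G(1) ac
          by (intro add_mono mult_right_mono mult_left_mono diff_right_mono) auto
        finally show ?thesis by (intro mult_left_mono) auto
      qed simp
    qed
    also have "\<dots> = \<kappa> * T J + \<mu> * S J"
      by (simp add: \<kappa>_def T_def S_def a_def c_def sum_distrib_left distrib_left sum.distrib ac_simps)
    finally show ?thesis .
  qed
  have TS: "0 \<le> T J" "0 \<le> S J" for J by (auto simp: T_def S_def intro!: sum_nonneg)
  have "w - bilin_step L R P M N K b u v
      = stack g K (\<lambda>J. W J - lin_comb K (row P J) (\<lambda>i. b (X i) (Y i)))"
    unfolding w bilin_step_def X_def Y_def dims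
    using W by (intro stack_diff) (auto simp: fl_lin_comb_def)
  then have "lp_norm p (w - bilin_step L R P M N K b u v)
      = lp_set p (\<lambda>J. lp_norm p (W J - lin_comb K (row P J) (\<lambda>i. b (X i) (Y i)))) {..<g}"
    using lp_norm_stack[OF assms(1) minus_carrier_vec] W by (simp add: fl_lin_comb_def)
  also have "\<dots> \<le> lp_set p (\<lambda>J. \<kappa> * T J + \<mu> * S J) {..<g}"
    using dW assms(1) by (intro lp_set_mono) (auto intro: order_trans[OF _ abs_ge_self])
  also have "\<dots> \<le> lp_set p (\<lambda>J. \<kappa> * T J) {..<g} + lp_set p (\<lambda>J. \<mu> * S J) {..<g}"
    using assms(1) by (intro lp_set_triangle) auto
  also have "\<dots> = \<kappa> * growth_factor p q L R P + \<mu> * lp_set p S {..<g}"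
    using pos assms(1) by (simp add: lp_set_scale growth_factor_eq T_def)
  finally show ?thesis by (simp add: \<kappa>_def \<mu>_def S_def h_def ac_simps)
qed

end

text \<open>The constant \<open>4 ^ n\<close> is chosen for an easy induction; any constant independent of \<open>\<epsilon>\<close>
  leads to an error of second order.\<close>

lemma one_plus_power_le:
  fixes \<epsilon> :: real
  assumes "0 \<le> \<epsilon>" "\<epsilon> \<le> 1"
  shows "(1 + \<epsilon>) ^ n \<le> 1 + 4 ^ n * \<epsilon>" "(1 + \<epsilon>) ^ n \<le> 1 + real n * \<epsilon> + 4 ^ n * \<epsilon>\<^sup>2"
proof -
  have "(1 + \<epsilon>) ^ n \<le> 1 + 4 ^ n * \<epsilon> \<and> (1 + \<epsilon>) ^ n \<le> 1 + real n * \<epsilon> + 4 ^ n * \<epsilon>\<^sup>2"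
  proof (induction n)
    case (Suc n)
    have one: "1 \<le> (4::real) ^ n" by simp
    have n: "real n \<le> 4 ^ n"
      using of_nat_less_two_power[of n, where 'a = real] power_mono[of 2 "4::real" n] by linarith
    have eps: "\<epsilon>\<^sup>2 \<le> \<epsilon>" "0 \<le> \<epsilon>\<^sup>2" "\<epsilon> * \<epsilon>\<^sup>2 \<le> \<epsilon>\<^sup>2"
      using assms by (auto simp: power2_eq_square mult_left_le mult_left_le_one_le)
    have "(1 + \<epsilon>) ^ Suc n \<le> (1 + \<epsilon>) * (1 + 4 ^ n * \<epsilon>)"
      using Suc assms by (simp add: mult_left_mono)
    also have "\<dots> = 1 + \<epsilon> + 4 ^ n * \<epsilon> + 4 ^ n * \<epsilon>\<^sup>2"
      by (simp add: algebra_simps power2_eq_square)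
    also have "\<dots> \<le> 1 + 4 ^ n * \<epsilon> + 4 ^ n * \<epsilon> + 4 ^ n * \<epsilon>"
      using one eps assms by (intro add_mono mult_left_mono) (auto simp: mult_le_cancel_right1)
    also have "\<dots> \<le> 1 + 4 ^ Suc n * \<epsilon>" using assms by simp
    finally have 1: "(1 + \<epsilon>) ^ Suc n \<le> 1 + 4 ^ Suc n * \<epsilon>" .
    have "(1 + \<epsilon>) ^ Suc n \<le> (1 + \<epsilon>) * (1 + real n * \<epsilon> + 4 ^ n * \<epsilon>\<^sup>2)"
      using Suc assms by (simp add: mult_left_mono)
    also have "\<dots> = 1 + real (Suc n) * \<epsilon> + (real n * \<epsilon>\<^sup>2 + 4 ^ n * \<epsilon>\<^sup>2 + 4 ^ n * (\<epsilon> * \<epsilon>\<^sup>2))"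
      by (simp add: algebra_simps power2_eq_square)
    also have "\<dots> \<le> 1 + real (Suc n) * \<epsilon> + (4 ^ n * \<epsilon>\<^sup>2 + 4 ^ n * \<epsilon>\<^sup>2 + 4 ^ n * \<epsilon>\<^sup>2)"
    proof -
      have "real n * \<epsilon>\<^sup>2 \<le> 4 ^ n * \<epsilon>\<^sup>2" using n by (intro mult_right_mono) auto
      moreover have "4 ^ n * (\<epsilon> * \<epsilon>\<^sup>2) \<le> 4 ^ n * \<epsilon>\<^sup>2" using eps(3) by (intro mult_left_mono) auto
      ultimately show ?thesis by linarith
    qed
    also have "\<dots> \<le> 1 + real (Suc n) * \<epsilon> + 4 ^ Suc n * \<epsilon>\<^sup>2" using eps by simp
    finally show ?case using 1 by simp
  qed (use assms in simp)
  then show "(1 + \<epsilon>) ^ n \<le> 1 + 4 ^ n * \<epsilon>" "(1 + \<epsilon>) ^ n \<le> 1 + real n * \<epsilon> + 4 ^ n * \<epsilon>\<^sup>2"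
    by auto
qed

text \<open>Expanding the powers of \<open>1 + \<epsilon>\<close> in \<open>step_error\<close> to first order gives the recurrence for the error
  factors.\<close>

lemma (in recursion_step) forward_error_bound_step:
  assumes "1 \<le> p" "1 \<le> q"
    and G: "0 \<le> G" "\<And>u v. u \<in> carrier_vec M \<Longrightarrow> v \<in> carrier_vec N \<Longrightarrow>
      lp_norm p (b u v) \<le> G * lp_norm q u * lp_norm q v"
    and F: "0 \<le> F"
    and A: "forward_error_bound p q M N b A F"
    and A_carrier: "\<And>\<epsilon> u v w. 0 < \<epsilon> \<Longrightarrow> u \<in> carrier_vec M \<Longrightarrow> v \<in> carrier_vec N \<Longrightarrow>
      A \<epsilon> u v w \<Longrightarrow> w \<in> carrier_vec K"
    and Q: "\<And>J i. J < g \<Longrightarrow> i < r \<Longrightarrow> P $$ (J, i) \<noteq> 0 \<Longrightarrow>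
      nnz (row P J) + (nnz (row L i) + nnz (row R i)) \<le> Q"
  shows "forward_error_bound p q (e * M) (f * N) (bilin_step L R P M N K b)
    (fl_bilin_step L R P M N K A) (growth_factor p q L R P * (F + real Q * G))"
  unfolding forward_error_bound_def
proof (intro allI)
  fix B
  let ?\<gamma> = "growth_factor p q L R P"
  define l where "l = (\<lambda>i. 2 ^ nnz (row L i) * lp_norm (conj_exponent q) (row L i))"
  define m where "m = (\<lambda>i. 2 ^ nnz (row R i) * lp_norm (conj_exponent q) (row R i))"
  \<comment> \<open>For \<open>\<epsilon> \<le> 1\<close>, all inputs of the recursive calls have norm at most \<open>B'\<close>.\<close>
  define B' where "B' = (\<Sum>i<r. l i + m i) * \<bar>B\<bar>"
  obtain C0 where C0: "\<forall>\<^sub>F \<epsilon> in at_right 0. \<forall>u\<in>carrier_vec M. \<forall>v\<in>carrier_vec N. \<forall>w.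
      lp_norm q u \<le> B' \<longrightarrow> lp_norm q v \<le> B' \<longrightarrow> A \<epsilon> u v w \<longrightarrow>
      lp_norm p (w - b u v) \<le> F * lp_norm q u * lp_norm q v * \<epsilon> + C0 * \<epsilon>\<^sup>2"
    using A unfolding forward_error_bound_def by blast
  define C where "C = max C0 0"
  define S where "S = lp_set p (\<lambda>J. \<Sum>i<r. \<bar>P $$ (J, i)\<bar>) {..<g}"
  define k where "k = (4 :: real) ^ Q"
  have nn: "0 \<le> l i" "0 \<le> m i" for i by (simp_all add: l_def m_def)
  have CS: "0 \<le> C" "0 \<le> S" "0 \<le> k" by (simp_all add: C_def S_def k_def)
  have \<gamma>: "0 \<le> ?\<gamma>" by (simp add: growth_factor_def)
  define C' where "C' = ?\<gamma> * (F + G) * k * B\<^sup>2 + C * (1 + k) * S"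
  have small: "\<forall>\<^sub>F \<epsilon> in at_right 0. 0 < \<epsilon> \<and> \<epsilon> \<le> (1::real)"
    unfolding eventually_at_right_field by (rule exI[of _ 1]) auto
  have "\<forall>\<^sub>F \<epsilon> in at_right 0. \<forall>u\<in>carrier_vec (e * M). \<forall>v\<in>carrier_vec (f * N). \<forall>w.
      lp_norm q u \<le> B \<longrightarrow> lp_norm q v \<le> B \<longrightarrow> fl_bilin_step L R P M N K A \<epsilon> u v w \<longrightarrow>
      lp_norm p (w - bilin_step L R P M N K b u v)
        \<le> ?\<gamma> * (F + real Q * G) * lp_norm q u * lp_norm q v * \<epsilon> + C' * \<epsilon>\<^sup>2"
    using C0 small
  proof eventually_elim
    case (elim \<epsilon>)
    show ?case
    proof (intro ballI allI impI)
      fix u v w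
      assume u: "u \<in> carrier_vec (e * M)" and v: "v \<in> carrier_vec (f * N)"
        and uB: "lp_norm q u \<le> B" and vB: "lp_norm q v \<le> B"
        and step: "fl_bilin_step L R P M N K A \<epsilon> u v w"
      have eps: "0 < \<epsilon>" "\<epsilon> \<le> 1" using elim by auto
      define U where "U = lp_norm q u * lp_norm q v"
      have U: "0 \<le> U" "U \<le> B\<^sup>2"
        using uB vB mult_mono[OF uB vB] order_trans[OF lp_norm_nonneg uB]
        by (auto simp: U_def power2_eq_square)
      have in_B': "lp_norm q x \<le> B'"
        if "i < r" "lp_norm q x \<le> (1 + \<epsilon>) ^ n * (\<alpha> * t)" "2 ^ n * \<alpha> \<le> l i + m i"
          "0 \<le> \<alpha>" "0 \<le> t" "t \<le> B" for x i n \<alpha> t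
      proof -
        have "lp_norm q x \<le> 2 ^ n * (\<alpha> * t)"
          using that eps by (intro order_trans[OF that(2)] mult_right_mono power_mono) auto
        also have "\<dots> = (2 ^ n * \<alpha>) * t" by simp
        also have "\<dots> \<le> (\<Sum>i<r. l i + m i) * \<bar>B\<bar>"
        proof (rule mult_mono)
          have "l i + m i \<le> (\<Sum>i<r. l i + m i)"
            using that nn by (intro member_le_sum) auto
          then show "2 ^ n * \<alpha> \<le> (\<Sum>i<r. l i + m i)" using that by linarith
        qed (use that nn in \<open>auto intro!: sum_nonneg add_nonneg_nonneg\<close>)
        finally show ?thesis by (simp add: B'_def)
      qed
      have rec: "z \<in> carrier_vec K \<and>
          lp_norm p (z - b x y) \<le> F * lp_norm q x * lp_norm q y * \<epsilon> + C * \<epsilon>\<^sup>2"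
        if i: "i < r" and x: "x \<in> carrier_vec M" and y: "y \<in> carrier_vec N"
          and xb: "lp_norm q x \<le> (1 + \<epsilon>) ^ nnz (row L i) * (lp_norm (conj_exponent q) (row L i) * lp_norm q u)"
          and yb: "lp_norm q y \<le> (1 + \<epsilon>) ^ nnz (row R i) * (lp_norm (conj_exponent q) (row R i) * lp_norm q v)"
          and z: "A \<epsilon> x y z" for i x y z
      proof
        show "z \<in> carrier_vec K" using A_carrier[OF eps(1) x y z] .
        have "lp_norm q x \<le> B'" "lp_norm q y \<le> B'"
          using in_B'[OF i xb] in_B'[OF i yb] uB vB nn[of i] by (simp_all add: l_def m_def)
        then have "lp_norm p (z - b x y) \<le> F * lp_norm q x * lp_norm q y * \<epsilon> + C0 * \<epsilon>\<^sup>2"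
          using elim x y z by blast
        also have "\<dots> \<le> F * lp_norm q x * lp_norm q y * \<epsilon> + C * \<epsilon>\<^sup>2"
          by (intro add_left_mono mult_right_mono) (auto simp: C_def)
        finally show "lp_norm p (z - b x y) \<le> F * lp_norm q x * lp_norm q y * \<epsilon> + C * \<epsilon>\<^sup>2" .
      qed
      have pow: "(1 + \<epsilon>) ^ Q \<le> 1 + k * \<epsilon>" "(1 + \<epsilon>) ^ Q - 1 \<le> real Q * \<epsilon> + k * \<epsilon>\<^sup>2" "(1 + \<epsilon>) ^ Q \<le> 1 + k"
      proof -
        show "(1 + \<epsilon>) ^ Q \<le> 1 + k * \<epsilon>" "(1 + \<epsilon>) ^ Q - 1 \<le> real Q * \<epsilon> + k * \<epsilon>\<^sup>2"
          using one_plus_power_le[of \<epsilon> Q] eps by (auto simp: k_def)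
        then show "(1 + \<epsilon>) ^ Q \<le> 1 + k"
          using mult_left_le[OF eps(2) CS(3)] by linarith
      qed
      have "lp_norm p (w - bilin_step L R P M N K b u v)
          \<le> ?\<gamma> * (F * \<epsilon> * (1 + \<epsilon>) ^ Q + G * ((1 + \<epsilon>) ^ Q - 1)) * U + C * \<epsilon>\<^sup>2 * (1 + \<epsilon>) ^ Q * S"
        unfolding U_def S_def
        using step_error[OF assms(1,2) u v G F CS(1) less_imp_le[OF eps(1)] Q rec step] by simp
      also have "\<dots> \<le> ?\<gamma> * (F * \<epsilon> * (1 + k * \<epsilon>) + G * (real Q * \<epsilon> + k * \<epsilon>\<^sup>2)) * U + C * \<epsilon>\<^sup>2 * (1 + k) * S"
        using pow eps CS G(1) F \<gamma> U
        by (intro add_mono mult_right_mono mult_left_mono) auto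
      also have "\<dots> = ?\<gamma> * (F + real Q * G) * U * \<epsilon> + (?\<gamma> * (F + G) * k * U + C * (1 + k) * S) * \<epsilon>\<^sup>2"
        by (simp add: algebra_simps power2_eq_square)
      also have "\<dots> \<le> ?\<gamma> * (F + real Q * G) * U * \<epsilon> + C' * \<epsilon>\<^sup>2"
        unfolding C'_def using U \<gamma> F G(1) CS
        by (intro add_left_mono mult_right_mono add_right_mono mult_left_mono) auto
      finally show "lp_norm p (w - bilin_step L R P M N K b u v)
          \<le> ?\<gamma> * (F + real Q * G) * lp_norm q u * lp_norm q v * \<epsilon> + C' * \<epsilon>\<^sup>2"
        by (simp add: U_def mult.assoc)
    qed
  qed
  then show "\<exists>C. \<forall>\<^sub>F \<epsilon> in at_right 0. \<forall>u\<in>carrier_vec (e * M). \<forall>v\<in>carrier_vec (f * N). \<forall>w.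
      lp_norm q u \<le> B \<longrightarrow> lp_norm q v \<le> B \<longrightarrow> fl_bilin_step L R P M N K A \<epsilon> u v w \<longrightarrow>
      lp_norm p (w - bilin_step L R P M N K b u v)
        \<le> ?\<gamma> * (F + real Q * G) * lp_norm q u * lp_norm q v * \<epsilon> + C * \<epsilon>\<^sup>2" by blast
qed

section \<open>Matrix multiplication\<close>

text \<open>A bound for the norm of a matrix multiplication when \<open>p, q \<in> {2, \<infinity>}\<close>. In contrast to \<^const>\<open>matmul_factor\<close>,
  which dominates it, it is multiplicative in the dimensions.\<close>

definition matmul_norm :: "ereal \<Rightarrow> ereal \<Rightarrow> nat \<Rightarrow> nat \<Rightarrow> nat \<Rightarrow> real" where
  "matmul_norm p q m k n =
     (if q = 2 then 1 else if p = \<infinity> then real k else real k * sqrt (real m * real n))"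

lemma matmul_norm_nonneg: "0 \<le> matmul_norm p q m k n"
  by (simp add: matmul_norm_def)

lemma matmul_norm_le_factor: "matmul_norm p q m k n \<le> matmul_factor p q m k n"
  by (simp add: matmul_norm_def matmul_factor_def)

lemma matmul_norm_mult:
  "matmul_norm p q (m * m') (k * k') (n * n') = matmul_norm p q m k n * matmul_norm p q m' k' n'"
proof -
  have "sqrt (real (m * m') * real (n * n')) = sqrt (real m * real n) * sqrt (real m' * real n')"
    by (simp add: real_sqrt_mult)
  then show ?thesis by (simp add: matmul_norm_def)
qed

lemma lp_set_2_power2: "(lp_set 2 f A)\<^sup>2 = (\<Sum>i\<in>A. (f i)\<^sup>2)"
proof -
  have "lp_set 2 f A = sqrt (\<Sum>i\<in>A. (f i)\<^sup>2)"
    using lp_set_ereal[of 2 f A] by (simp add: powr_half_sqrt sum_nonneg)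
  then show ?thesis by (simp add: sum_nonneg)
qed

lemma lp_set_infty_le_2:
  assumes "finite A"
  shows "lp_set \<infinity> f A \<le> lp_set 2 f A"
proof -
  have "\<bar>f i\<bar> \<le> lp_set 2 f A" if "i \<in> A" for i
  proof (rule power2_le_imp_le)
    show "\<bar>f i\<bar>\<^sup>2 \<le> (lp_set 2 f A)\<^sup>2"
      unfolding lp_set_2_power2 power2_abs using assms that
      by (intro member_le_sum) auto
  qed (use assms in simp)
  then show ?thesis using assms by (simp add: lp_set_infty_le_iff)
qed

text \<open>For \<open>q = 2\<close>, Cauchy-Schwarz shows that the Frobenius norm is submultiplicative, and the maximum norm is
  dominated by it. For \<open>q = \<infinity>\<close>, every entry is a sum of \<open>k\<close> products of bounded entries.\<close>

lemma matmul_norm_bound: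
  fixes a c :: "nat \<times> nat \<Rightarrow> real"
  assumes "p \<in> {2, \<infinity>}" "q \<in> {2, \<infinity>}"
  shows "lp_set p (\<lambda>(i, j). \<Sum>h<k. a (i, h) * c (h, j)) ({..<m} \<times> {..<n})
    \<le> matmul_norm p q m k n * lp_set q a ({..<m} \<times> {..<k}) * lp_set q c ({..<k} \<times> {..<n})"
proof -
  define x where "x = (\<lambda>(i, j). \<Sum>h<k. a (i, h) * c (h, j))"
  let ?I = "{..<m} \<times> {..<n}"
  show ?thesis
  proof (cases "q = 2")
    case True
    have "lp_set 2 x ?I \<le> lp_set 2 a ({..<m} \<times> {..<k}) * lp_set 2 c ({..<k} \<times> {..<n})"
    proof (rule power2_le_imp_le)
      have "(lp_set 2 x ?I)\<^sup>2 = (\<Sum>i<m. \<Sum>j<n. (\<Sum>h<k. a (i, h) * c (h, j))\<^sup>2)"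
        unfolding lp_set_2_power2 x_def by (simp add: case_prod_unfold sum.cartesian_product)
      also have "\<dots> \<le> (\<Sum>i<m. \<Sum>j<n. (\<Sum>h<k. (a (i, h))\<^sup>2) * (\<Sum>h<k. (c (h, j))\<^sup>2))"
        by (intro sum_mono Cauchy_Schwarz_ineq_sum)
      also have "\<dots> = (\<Sum>i<m. \<Sum>h<k. (a (i, h))\<^sup>2) * (\<Sum>j<n. \<Sum>h<k. (c (h, j))\<^sup>2)"
        by (simp add: sum_product)
      also have "(\<Sum>j<n. \<Sum>h<k. (c (h, j))\<^sup>2) = (\<Sum>h<k. \<Sum>j<n. (c (h, j))\<^sup>2)"
        by (rule sum.swap)
      also have "(\<Sum>i<m. \<Sum>h<k. (a (i, h))\<^sup>2) * (\<Sum>h<k. \<Sum>j<n. (c (h, j))\<^sup>2)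
          = (lp_set 2 a ({..<m} \<times> {..<k}) * lp_set 2 c ({..<k} \<times> {..<n}))\<^sup>2"
        unfolding power_mult_distrib lp_set_2_power2
        by (simp add: sum.cartesian_product case_prod_unfold)
      finally show "(lp_set 2 x ?I)\<^sup>2
          \<le> (lp_set 2 a ({..<m} \<times> {..<k}) * lp_set 2 c ({..<k} \<times> {..<n}))\<^sup>2" .
    qed simp
    moreover have "lp_set p x ?I \<le> lp_set 2 x ?I"
      using assms(1) lp_set_infty_le_2[of ?I x] by auto
    ultimately show ?thesis using True by (simp add: matmul_norm_def x_def)
  next
    case False
    then have q: "q = \<infinity>" using assms(2) by auto
    define D where "D = lp_set \<infinity> a ({..<m} \<times> {..<k}) * lp_set \<infinity> c ({..<k} \<times> {..<n})"
    have D: "0 \<le> D" by (simp add: D_def)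
    have entry: "\<bar>x ij\<bar> \<le> real k * D" if mem: "ij \<in> ?I" for ij
    proof -
      obtain i j where ij: "ij = (i, j)" "i < m" "j < n" using mem by auto
      have "\<bar>x ij\<bar> \<le> (\<Sum>h<k. \<bar>a (i, h)\<bar> * \<bar>c (h, j)\<bar>)"
        unfolding x_def ij(1) by (simp add: order_trans[OF sum_abs] abs_mult)
      also have "\<dots> \<le> (\<Sum>h<k. D)"
        unfolding D_def using ij by (intro sum_mono mult_mono lp_set_infty_upper) auto
      finally show ?thesis by simp
    qed
    have "lp_set p x ?I \<le> matmul_norm p q m k n * D"
    proof (cases "p = \<infinity>")
      case True
      then show ?thesis using entry D q by (simp add: matmul_norm_def lp_set_infty_le_iff)
    next
      case False
      then have p: "p = 2" using assms(1) by auto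
      have "lp_set 2 x ?I \<le> real k * sqrt (real m * real n) * D"
      proof (rule power2_le_imp_le)
        have "(lp_set 2 x ?I)\<^sup>2 \<le> (\<Sum>ij\<in>?I. (real k * D)\<^sup>2)"
          unfolding lp_set_2_power2
        proof (rule sum_mono)
          fix ij assume "ij \<in> ?I"
          then show "(x ij)\<^sup>2 \<le> (real k * D)\<^sup>2"
            using entry power_mono[of "\<bar>x ij\<bar>" "real k * D" 2] by simp
        qed
        also have "\<dots> = (real k * sqrt (real m * real n) * D)\<^sup>2"
          by (simp add: power_mult_distrib card_cartesian_product)
        finally show "(lp_set 2 x ?I)\<^sup>2 \<le> (real k * sqrt (real m * real n) * D)\<^sup>2" .
      qed (use D in simp)
      then show ?thesis using p q by (simp add: matmul_norm_def)
    qed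
    then show ?thesis using q by (simp add: D_def x_def mult.assoc)
  qed
qed

lemma encodes_matmul_norm:
  assumes enc: "encodes_matmul m k n e f g b" and "p \<in> {2, \<infinity>}" "q \<in> {2, \<infinity>}"
    and u: "u \<in> carrier_vec e" and v: "v \<in> carrier_vec f" and "b u v \<in> carrier_vec g"
  shows "lp_norm p (b u v) \<le> matmul_norm p q m k n * lp_norm q u * lp_norm q v"
proof -
  obtain \<sigma>A \<sigma>B \<sigma>C where \<sigma>:
      "bij_betw \<sigma>A ({..<m} \<times> {..<k}) {..<e}" "bij_betw \<sigma>B ({..<k} \<times> {..<n}) {..<f}"
      "bij_betw \<sigma>C ({..<m} \<times> {..<n}) {..<g}"
    and entry: "\<And>i j. i < m \<Longrightarrow> j < n \<Longrightarrow> b u v $ \<sigma>C (i, j) = (\<Sum>h<k. u $ \<sigma>A (i, h) * v $ \<sigma>B (h, j))"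
    using enc u v unfolding encodes_matmul_def by blast
  have dims: "dim_vec u = e" "dim_vec v = f" "dim_vec (b u v) = g" using assms by auto
  have "lp_norm p (b u v) = lp_set p (\<lambda>ij. b u v $ \<sigma>C ij) ({..<m} \<times> {..<n})"
    by (simp add: lp_norm_eq_lp_set dims lp_set_reindex[OF \<sigma>(3)])
  also have "\<dots> = lp_set p (\<lambda>(i, j). \<Sum>h<k. u $ \<sigma>A (i, h) * v $ \<sigma>B (h, j)) ({..<m} \<times> {..<n})"
    by (rule lp_set_cong) (auto simp: entry)
  also have "\<dots> \<le> matmul_norm p q m k n * lp_set q (\<lambda>x. u $ \<sigma>A x) ({..<m} \<times> {..<k})
      * lp_set q (\<lambda>x. v $ \<sigma>B x) ({..<k} \<times> {..<n})"
    by (rule matmul_norm_bound[OF assms(2,3), where a = "\<lambda>x. u $ \<sigma>A x" and c = "\<lambda>x. v $ \<sigma>B x"])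
  also have "\<dots> = matmul_norm p q m k n * lp_norm q u * lp_norm q v"
    by (simp add: lp_norm_eq_lp_set dims lp_set_reindex[OF \<sigma>(1)] lp_set_reindex[OF \<sigma>(2)])
  finally show ?thesis .
qed

text \<open>The block-recursive storage order: \<open>\<sigma>\<close> places the blocks, and \<open>\<tau>\<close> the entries inside each block of
  \<open>M\<close> entries.\<close>

lemma bij_betw_block_recursive:
  fixes m k m' k' e M :: nat
  assumes \<sigma>: "bij_betw \<sigma> ({..<m} \<times> {..<k}) {..<e}" and \<tau>: "bij_betw \<tau> ({..<m'} \<times> {..<k'}) {..<M}"
  shows "bij_betw (\<lambda>(I, H). \<sigma> (I div m', H div k') * M + \<tau> (I mod m', H mod k'))
    ({..<m * m'} \<times> {..<k * k'}) {..<e * M}"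
proof -
  let ?split = "\<lambda>(I, H). ((I div m', H div k'), (I mod m', H mod k'))"
  have "bij_betw ?split ({..<m * m'} \<times> {..<k * k'})
      (({..<m} \<times> {..<k}) \<times> ({..<m'} \<times> {..<k'}))"
  proof (rule bij_betwI[where g = "\<lambda>((i, h), (i', h')). (i * m' + i', h * k' + h')"])
    show "?split \<in> {..<m * m'} \<times> {..<k * k'} \<rightarrow> ({..<m} \<times> {..<k}) \<times> {..<m'} \<times> {..<k'}"
      using block_coordinates by auto
  qed (auto intro: block_index_less)
  moreover have "bij_betw (map_prod \<sigma> \<tau>) (({..<m} \<times> {..<k}) \<times> ({..<m'} \<times> {..<k'})) ({..<e} \<times> {..<M})"
    using \<sigma> \<tau> by (rule bij_betw_map_prod)
  ultimately have "bij_betw ((\<lambda>(J, c). J * M + c) \<circ> (map_prod \<sigma> \<tau> \<circ> ?split))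
      ({..<m * m'} \<times> {..<k * k'}) {..<e * M}"
    using bij_betw_block_index by (blast intro: bij_betw_trans)
  moreover have "(\<lambda>(J, c). J * M + c) \<circ> (map_prod \<sigma> \<tau> \<circ> ?split)
      = (\<lambda>(I, H). \<sigma> (I div m', H div k') * M + \<tau> (I mod m', H mod k'))"
    by (auto simp: fun_eq_iff)
  ultimately show ?thesis by simp
qed

lemma sum_block_index:
  fixes F :: "nat \<Rightarrow> nat \<Rightarrow> 'a :: comm_monoid_add"
  shows "(\<Sum>H<k * k'. F (H div k') (H mod k')) = (\<Sum>h<k. \<Sum>h'<k'. F h h')"
proof -
  have "(\<Sum>H<k * k'. F (H div k') (H mod k'))
      = (\<Sum>(h, h')\<in>{..<k} \<times> {..<k'}. F ((h * k' + h') div k') ((h * k' + h') mod k'))"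
    by (subst sum.reindex_bij_betw[OF bij_betw_block_index, symmetric]) (simp add: case_prod_unfold)
  also have "\<dots> = (\<Sum>(h, h')\<in>{..<k} \<times> {..<k'}. F h h')"
    by (rule sum.cong) auto
  finally show ?thesis by (simp add: sum.cartesian_product)
qed

context recursion_step
begin

text \<open>Let \<open>s'\<close> be an entry at which \<open>b\<close> is a sum of products of input entries. Then the step acts on the blocks
  like \<open>\<beta>\<close>, separately for each such product: \<open>\<beta>\<close> is applied to the vectors that collect one fixed entry from
  every block.\<close>

lemma step_entry:
  assumes u: "u \<in> carrier_vec (e * M)" and v: "v \<in> carrier_vec (f * N)"
    and rep: "represents L R P \<beta>"
    and b_entry: "\<And>x y. x \<in> carrier_vec M \<Longrightarrow> y \<in> carrier_vec N \<Longrightarrow>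
      b x y $ s' = (\<Sum>h\<in>H. x $ \<alpha> h * y $ \<delta> h)"
    and idx: "s < g" "s' < K" "\<And>h. h \<in> H \<Longrightarrow> \<alpha> h < M" "\<And>h. h \<in> H \<Longrightarrow> \<delta> h < N"
  shows "bilin_step L R P M N K b u v $ (s * K + s')
    = (\<Sum>h\<in>H. \<beta> (vec e (\<lambda>j. u $ (j * M + \<alpha> h))) (vec f (\<lambda>j. v $ (j * N + \<delta> h))) $ s)"
proof -
  let ?u = "\<lambda>h. vec e (\<lambda>j. u $ (j * M + \<alpha> h))" and ?v = "\<lambda>h. vec f (\<lambda>j. v $ (j * N + \<delta> h))"
  have x: "lin_comb M (row L i) (block M u) $ \<alpha> h = row L i \<bullet> ?u h" if "h \<in> H" "i < r" for h i
    using idx that by (simp add: scalar_prod_def atLeast0LessThan)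
  have y: "lin_comb N (row R i) (block N v) $ \<delta> h = row R i \<bullet> ?v h" if "h \<in> H" "i < r" for h i
    using idx that by (simp add: scalar_prod_def atLeast0LessThan)
  have "bilin_step L R P M N K b u v $ (s * K + s')
      = (\<Sum>i<r. P $$ (s, i) *
          b (lin_comb M (row L i) (block M u)) (lin_comb N (row R i) (block N v)) $ s')"
    using idx by (simp add: bilin_step_def index_stack)
  also have "\<dots> = (\<Sum>i<r. \<Sum>h\<in>H. P $$ (s, i) * (row L i \<bullet> ?u h) * (row R i \<bullet> ?v h))"
    using x y by (intro sum.cong) (simp_all add: b_entry sum_distrib_left mult.assoc)
  also have "\<dots> = (\<Sum>h\<in>H. \<Sum>i<r. P $$ (s, i) * (row L i \<bullet> ?u h) * (row R i \<bullet> ?v h))"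
    by (rule sum.swap)
  also have "\<dots> = (\<Sum>h\<in>H. \<beta> (?u h) (?v h) $ s)"
    using rep idx by (intro sum.cong) (simp_all add: represents_def)
  finally show ?thesis .
qed

text \<open>Multiplying \<open>m \<times> k\<close> by \<open>k \<times> n\<close> matrices whose entries are \<open>m' \<times> k'\<close> and \<open>k' \<times> n'\<close> blocks is a matrix
  multiplication of the multiplied dimensions.\<close>

lemma encodes_matmul_step:
  assumes rep: "represents L R P \<beta>" and \<beta>: "encodes_matmul m k n e f g \<beta>"
    and b: "encodes_matmul m' k' n' M N K b"
  shows "encodes_matmul (m * m') (k * k') (n * n') (e * M) (f * N) (g * K)
    (bilin_step L R P M N K b)"
proof -
  obtain \<sigma>A \<sigma>B \<sigma>C where
      sA: "bij_betw \<sigma>A ({..<m} \<times> {..<k}) {..<e}" and sB: "bij_betw \<sigma>B ({..<k} \<times> {..<n}) {..<f}"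
      and sC: "bij_betw \<sigma>C ({..<m} \<times> {..<n}) {..<g}"
    and \<beta>_entry: "\<And>u v i j. u \<in> carrier_vec e \<Longrightarrow> v \<in> carrier_vec f \<Longrightarrow> i < m \<Longrightarrow> j < n \<Longrightarrow>
      \<beta> u v $ \<sigma>C (i, j) = (\<Sum>h<k. u $ \<sigma>A (i, h) * v $ \<sigma>B (h, j))"
    using \<beta> unfolding encodes_matmul_def by blast
  obtain \<tau>A \<tau>B \<tau>C where
      tA: "bij_betw \<tau>A ({..<m'} \<times> {..<k'}) {..<M}" and tB: "bij_betw \<tau>B ({..<k'} \<times> {..<n'}) {..<N}"
      and tC: "bij_betw \<tau>C ({..<m'} \<times> {..<n'}) {..<K}"
    and b_entry: "\<And>u v i j. u \<in> carrier_vec M \<Longrightarrow> v \<in> carrier_vec N \<Longrightarrow> i < m' \<Longrightarrow> j < n' \<Longrightarrow>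
      b u v $ \<tau>C (i, j) = (\<Sum>h<k'. u $ \<tau>A (i, h) * v $ \<tau>B (h, j))"
    using b unfolding encodes_matmul_def by blast
  have bound: "\<sigma> (i, j) < x" if "bij_betw \<sigma> ({..<y} \<times> {..<z}) {..<x}" "i < y" "j < z"
    for \<sigma> :: "nat \<times> nat \<Rightarrow> nat" and x y z i j
    using bij_betwE[OF that(1)] that by auto
  let ?A = "\<lambda>(I, H). \<sigma>A (I div m', H div k') * M + \<tau>A (I mod m', H mod k')"
  let ?B = "\<lambda>(H, J). \<sigma>B (H div k', J div n') * N + \<tau>B (H mod k', J mod n')"
  let ?C = "\<lambda>(I, J). \<sigma>C (I div m', J div n') * K + \<tau>C (I mod m', J mod n')"
  have "bilin_step L R P M N K b u v $ ?C (I, J) = (\<Sum>H<k * k'. u $ ?A (I, H) * v $ ?B (H, J))"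
    if u: "u \<in> carrier_vec (e * M)" and v: "v \<in> carrier_vec (f * N)"
      and I: "I < m * m'" and J: "J < n * n'" for u v I J
  proof -
    define i i' j j' where ij: "i = I div m'" "i' = I mod m'" "j = J div n'" "j' = J mod n'"
    have lt: "i < m" "j < n" "i' < m'" "j' < n'"
      using I J unfolding ij
      by (simp_all add: block_coordinates)
    have "bilin_step L R P M N K b u v $ (\<sigma>C (i, j) * K + \<tau>C (i', j'))
        = (\<Sum>h'<k'. \<beta> (vec e (\<lambda>t. u $ (t * M + \<tau>A (i', h')))) (vec f (\<lambda>t. v $ (t * N + \<tau>B (h', j')))) $ \<sigma>C (i, j))"
      using lt by (intro step_entry[OF u v rep]) (auto intro: b_entry bound[OF sC] bound[OF tA] bound[OF tB] bound[OF tC])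
    also have "\<dots> = (\<Sum>h'<k'. \<Sum>h<k. u $ (\<sigma>A (i, h) * M + \<tau>A (i', h')) * v $ (\<sigma>B (h, j) * N + \<tau>B (h', j')))"
      using lt bound[OF sA lt(1)] bound[OF sB _ lt(2)]
      by (intro sum.cong refl) (simp add: \<beta>_entry)
    also have "\<dots> = (\<Sum>h<k. \<Sum>h'<k'. u $ (\<sigma>A (i, h) * M + \<tau>A (i', h')) * v $ (\<sigma>B (h, j) * N + \<tau>B (h', j')))"
      by (rule sum.swap)
    \<comment> \<open>The pairs \<open>(h, h')\<close> of an outer and an inner index are the indices \<open>H = h * k' + h'\<close>.\<close>
    also have "\<dots> = (\<Sum>H<k * k'. u $ ?A (I, H) * v $ ?B (H, J))"
      by (simp add: ij flip: sum_block_index)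
    finally show ?thesis by (simp add: ij)
  qed
  moreover have "e = m * k" "f = k * n" "g = m * n" "M = m' * k'" "N = k' * n'" "K = m' * n'"
    using \<beta> b by (auto simp: encodes_matmul_def)
  ultimately show ?thesis
    unfolding encodes_matmul_def
    using bij_betw_block_recursive[OF sA tA] bij_betw_block_recursive[OF sB tB]
      bij_betw_block_recursive[OF sC tC]
    by (intro conjI exI[of _ ?A] exI[of _ ?B] exI[of _ ?C]) (auto simp: ac_simps)
qed

end

section \<open>The forward error of the recursion\<close>

lemma nnz_le_Q0:
  assumes "J < dim_row P" "i < dim_col P" "P $$ (J, i) \<noteq> 0"
  shows "nnz (row P J) + (nnz (row L i) + nnz (row R i)) \<le> Q0 L R P"
proof -
  let ?m = "\<lambda>J. Max ((\<lambda>i. if P $$ (J, i) \<noteq> 0 then nnz (row L i) + nnz (row R i) else 0) ` {..<dim_col P})"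
  have "nnz (row L i) + nnz (row R i) \<le> ?m J"
    using assms by (intro Max_ge) (auto intro!: image_eqI[of _ _ i])
  also have "nnz (row P J) + ?m J \<le> Q0 L R P"
    unfolding Q0_def using assms by (intro Max_ge) auto
  finally show ?thesis by simp
qed

lemma lp_norm_pos:
  assumes "0 < n" "1 \<le> q"
  obtains x where "x \<in> carrier_vec n" "0 < lp_norm q x"
proof
  let ?x = "vec n (\<lambda>_. 1 :: real)"
  show "?x \<in> carrier_vec n" by simp
  have "lp_norm q ?x \<noteq> 0"
    using lp_set_eq_0D[of "{..<n}" q "($) ?x" 0] assms by (auto simp: lp_norm_eq_lp_set)
  then show "0 < lp_norm q ?x" using lp_norm_nonneg[of q ?x] by linarith
qed

lemma lp_norm_empty: "1 \<le> q \<Longrightarrow> x \<in> carrier_vec 0 \<Longrightarrow> lp_norm q x = 0"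
  using lp_set_eq_0I[of "{}" q "($) x"] by (simp add: lp_norm_eq_lp_set)

lemma bilinear_map_bilin_pow:
  assumes "L \<in> carrier_mat r e" "R \<in> carrier_mat r f" "P \<in> carrier_mat g r"
    and "bilinear_map e0 f0 g0 \<beta>0"
  shows "bilinear_map (e0 * e ^ l) (f0 * f ^ l) (g0 * g ^ l) (bilin_pow L R P e0 f0 g0 \<beta>0 l)"
proof (induction l)
  case 0
  have "bilin_pow L R P e0 f0 g0 \<beta>0 0 = \<beta>0" by (intro ext) simp
  then show ?case using assms by simp
next
  case (Suc l)
  interpret recursion_step L R P e f g r "e0 * e ^ l" "f0 * f ^ l" "g0 * g ^ l"
    "bilin_pow L R P e0 f0 g0 \<beta>0 l"
    by (rule recursion_step.intro[OF assms(1-3) Suc])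
  show ?case using bilinear_map_step by (simp add: bilin_pow_Suc ac_simps del: bilin_pow.simps)
qed

text \<open>The recurrence \<open>F\<^sub>l\<^sub>+\<^sub>1 = \<gamma> (F\<^sub>l + Q0 \<Gamma>0 \<Gamma>\<^sup>l)\<close> unrolled, for any constants \<open>\<Gamma>0\<close> and \<open>\<Gamma>\<close> that control the norm
  at every level.\<close>

lemma forward_error_bound_bilin_pow:
  assumes "1 \<le> p" "1 \<le> q"
    and "L \<in> carrier_mat r e" "R \<in> carrier_mat r f" "P \<in> carrier_mat g r"
    and \<beta>0: "bilinear_map e0 f0 g0 \<beta>0"
    and A0: "fl_algorithm e0 f0 g0 A0" "forward_error_bound p q e0 f0 \<beta>0 A0 F0"
    and \<gamma>: "\<gamma> = growth_factor p q L R P" "\<gamma> \<noteq> 0"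
    and nn: "0 \<le> F0" "0 \<le> \<Gamma>0" "0 \<le> \<Gamma>"
    and norm: "\<And>l u v. u \<in> carrier_vec (e0 * e ^ l) \<Longrightarrow> v \<in> carrier_vec (f0 * f ^ l) \<Longrightarrow>
      lp_norm p (bilin_pow L R P e0 f0 g0 \<beta>0 l u v) \<le> \<Gamma>0 * \<Gamma> ^ l * lp_norm q u * lp_norm q v"
  shows "forward_error_bound p q (e0 * e ^ l) (f0 * f ^ l)
    (bilin_pow L R P e0 f0 g0 \<beta>0 l) (fl_bilin_pow L R P e0 f0 g0 A0 l)
    (\<gamma> ^ l * (F0 + real (Q0 L R P) * \<Gamma>0 * (\<Sum>i<l. (\<Gamma> / \<gamma>) ^ i)))"
proof (induction l)
  case 0
  have "bilin_pow L R P e0 f0 g0 \<beta>0 0 = \<beta>0" by (intro ext) simp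
  then show ?case using A0 by simp
next
  case (Suc l)
  let ?b = "bilin_pow L R P e0 f0 g0 \<beta>0 l" and ?A = "fl_bilin_pow L R P e0 f0 g0 A0 l"
  let ?F = "\<lambda>l. \<gamma> ^ l * (F0 + real (Q0 L R P) * \<Gamma>0 * (\<Sum>i<l. (\<Gamma> / \<gamma>) ^ i))"
  interpret recursion_step L R P e f g r "e0 * e ^ l" "f0 * f ^ l" "g0 * g ^ l" ?b
    by (rule recursion_step.intro[OF assms(3-5) bilinear_map_bilin_pow[OF assms(3-6)]])
  have "0 \<le> \<gamma>" by (simp add: \<gamma>(1) growth_factor_def)
  have carrier: "w \<in> carrier_vec (g0 * g ^ l)"
    if "0 < \<epsilon>" "u \<in> carrier_vec (e0 * e ^ l)" "v \<in> carrier_vec (f0 * f ^ l)" "?A \<epsilon> u v w" for \<epsilon> u v w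
    using that fl_algorithm_carrier[OF A0(1)]
    by (cases l) (auto simp: fl_bilin_pow_Suc fl_bilin_step_def ac_simps simp del: fl_bilin_pow.simps(2))
  have "forward_error_bound p q (e * (e0 * e ^ l)) (f * (f0 * f ^ l))
      (bilin_step L R P (e0 * e ^ l) (f0 * f ^ l) (g0 * g ^ l) ?b)
      (fl_bilin_step L R P (e0 * e ^ l) (f0 * f ^ l) (g0 * g ^ l) ?A)
      (growth_factor p q L R P * (?F l + real (Q0 L R P) * (\<Gamma>0 * \<Gamma> ^ l)))"
  proof (rule forward_error_bound_step[OF assms(1,2) _ norm _ Suc carrier])
    show "0 \<le> ?F l" using nn \<open>0 \<le> \<gamma>\<close> by (simp add: sum_nonneg)
    show "nnz (row P J) + (nnz (row L i) + nnz (row R i)) \<le> Q0 L R P"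
      if "J < g" "i < r" "P $$ (J, i) \<noteq> 0" for J i
      using that by (intro nnz_le_Q0) auto
  qed (use nn in simp_all)
  moreover have "growth_factor p q L R P * (?F l + real (Q0 L R P) * (\<Gamma>0 * \<Gamma> ^ l)) = ?F (Suc l)"
    using \<gamma> by (simp add: power_divide field_simps)
  ultimately show ?case
    by (simp add: bilin_pow_Suc fl_bilin_pow_Suc ac_simps del: bilin_pow.simps fl_bilin_pow.simps)
qed

lemma bilin_pow_norm_growth:
  assumes "1 \<le> p" "1 \<le> q"
    and "L \<in> carrier_mat r e" "R \<in> carrier_mat r f" "P \<in> carrier_mat g r"
    and \<beta>0: "bilinear_map e0 f0 g0 \<beta>0"
    and "0 \<le> \<Gamma>0"
    and base: "\<And>u v. u \<in> carrier_vec e0 \<Longrightarrow> v \<in> carrier_vec f0 \<Longrightarrow>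
      lp_norm p (\<beta>0 u v) \<le> \<Gamma>0 * lp_norm q u * lp_norm q v"
    and "u \<in> carrier_vec (e0 * e ^ l)" "v \<in> carrier_vec (f0 * f ^ l)"
  shows "lp_norm p (bilin_pow L R P e0 f0 g0 \<beta>0 l u v)
    \<le> \<Gamma>0 * growth_factor p q L R P ^ l * lp_norm q u * lp_norm q v"
  using assms(9,10)
proof (induction l arbitrary: u v)
  case 0
  then show ?case using base by simp
next
  case (Suc l)
  interpret recursion_step L R P e f g r "e0 * e ^ l" "f0 * f ^ l" "g0 * g ^ l"
    "bilin_pow L R P e0 f0 g0 \<beta>0 l"
    by (rule recursion_step.intro[OF assms(3-5) bilinear_map_bilin_pow[OF assms(3-6)]])
  have "0 \<le> growth_factor p q L R P" by (simp add: growth_factor_def)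
  then have "lp_norm p (bilin_step L R P (e0 * e ^ l) (f0 * f ^ l) (g0 * g ^ l) (bilin_pow L R P e0 f0 g0 \<beta>0 l) u v)
      \<le> \<Gamma>0 * growth_factor p q L R P ^ l * growth_factor p q L R P * lp_norm q u * lp_norm q v"
    using Suc assms(7) by (intro norm_step_le[OF assms(1,2)]) (simp_all add: ac_simps)
  then show ?case by (simp add: bilin_pow_Suc ac_simps del: bilin_pow.simps)
qed

lemma encodes_matmul_bilin_pow:
  assumes "L \<in> carrier_mat r e" "R \<in> carrier_mat r f" "P \<in> carrier_mat g r"
    and "bilinear_map e0 f0 g0 \<beta>0"
    and rep: "represents L R P \<beta>" and \<beta>: "encodes_matmul m k n e f g \<beta>"
    and base: "encodes_matmul m0 k0 n0 e0 f0 g0 \<beta>0"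
  shows "encodes_matmul (m0 * m ^ l) (k0 * k ^ l) (n0 * n ^ l) (e0 * e ^ l) (f0 * f ^ l) (g0 * g ^ l)
    (bilin_pow L R P e0 f0 g0 \<beta>0 l)"
proof (induction l)
  case 0
  have "bilin_pow L R P e0 f0 g0 \<beta>0 0 = \<beta>0" by (intro ext) simp
  then show ?case using base by simp
next
  case (Suc l)
  interpret recursion_step L R P e f g r "e0 * e ^ l" "f0 * f ^ l" "g0 * g ^ l"
    "bilin_pow L R P e0 f0 g0 \<beta>0 l"
    by (rule recursion_step.intro[OF assms(1-3) bilinear_map_bilin_pow[OF assms(1-4)]])
  show ?case using encodes_matmul_step[OF rep \<beta> Suc]
    by (simp add: bilin_pow_Suc mult.left_commute del: bilin_pow.simps)
qed

lemma bilin_pow_norm_matmul: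
  assumes "p \<in> {2, \<infinity>}" "q \<in> {2, \<infinity>}"
    and "L \<in> carrier_mat r e" "R \<in> carrier_mat r f" "P \<in> carrier_mat g r"
    and \<beta>0: "bilinear_map e0 f0 g0 \<beta>0"
    and rep: "represents L R P \<beta>" and \<beta>: "encodes_matmul m k n e f g \<beta>"
    and base: "encodes_matmul m0 k0 n0 e0 f0 g0 \<beta>0"
    and u: "u \<in> carrier_vec (e0 * e ^ l)" and v: "v \<in> carrier_vec (f0 * f ^ l)"
  shows "lp_norm p (bilin_pow L R P e0 f0 g0 \<beta>0 l u v)
    \<le> matmul_factor p q m0 k0 n0 * matmul_factor p q m k n ^ l * lp_norm q u * lp_norm q v"
proof -
  have pow: "matmul_norm p q (m0 * m ^ l) (k0 * k ^ l) (n0 * n ^ l)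
      = matmul_norm p q m0 k0 n0 * matmul_norm p q m k n ^ l"
  proof (induction l)
    case (Suc l)
    then show ?case
      using matmul_norm_mult[of p q m "m0 * m ^ l" k "k0 * k ^ l" n "n0 * n ^ l"]
      by (simp add: ac_simps)
  qed simp
  have "bilin_pow L R P e0 f0 g0 \<beta>0 l u v \<in> carrier_vec (g0 * g ^ l)"
    using bilinear_map_bilin_pow[OF assms(3-6), of l] u v by (simp add: bilinear_map_def)
  then have "lp_norm p (bilin_pow L R P e0 f0 g0 \<beta>0 l u v)
      \<le> matmul_norm p q m0 k0 n0 * matmul_norm p q m k n ^ l * lp_norm q u * lp_norm q v"
    using encodes_matmul_norm[OF encodes_matmul_bilin_pow[OF assms(3-9)] assms(1,2) u v] pow by simp
  also have "\<dots> \<le> matmul_factor p q m0 k0 n0 * matmul_factor p q m k n ^ l * lp_norm q u * lp_norm q v"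
    by (intro mult_right_mono mult_mono power_mono matmul_norm_le_factor matmul_norm_nonneg
        zero_le_power order_trans[OF matmul_norm_nonneg matmul_norm_le_factor]) auto
  finally show ?thesis .
qed

text \<open>For fixed inputs of positive norm, the bound divided by \<open>\<epsilon>\<close> stays nonnegative as \<open>\<epsilon>\<close> tends to \<open>0\<close>,
  and its limit is a positive multiple of \<open>F\<close>.\<close>

lemma forward_error_factor_nonneg:
  assumes "1 \<le> q" "0 < e" "0 < f" "fl_algorithm e f g A" "forward_error_bound p q e f \<beta> A F"
  shows "0 \<le> F"
proof -
  obtain u where u: "u \<in> carrier_vec e" "0 < lp_norm q u" using lp_norm_pos assms(1,2) by blast
  obtain v where v: "v \<in> carrier_vec f" "0 < lp_norm q v" using lp_norm_pos assms(1,3) by blast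
  define U where "U = lp_norm q u * lp_norm q v"
  have "0 < U" using u v by (simp add: U_def)
  obtain C where C: "\<forall>\<^sub>F \<epsilon> in at_right 0. \<forall>u'\<in>carrier_vec e. \<forall>v'\<in>carrier_vec f. \<forall>w.
      lp_norm q u' \<le> max (lp_norm q u) (lp_norm q v) \<longrightarrow>
      lp_norm q v' \<le> max (lp_norm q u) (lp_norm q v) \<longrightarrow> A \<epsilon> u' v' w \<longrightarrow>
      lp_norm p (w - \<beta> u' v') \<le> F * lp_norm q u' * lp_norm q v' * \<epsilon> + C * \<epsilon>\<^sup>2"
    using assms(5) unfolding forward_error_bound_def by blast
  have "\<forall>\<^sub>F \<epsilon> in at_right 0. - (C * \<epsilon>) \<le> F * U"
    using C eventually_at_right_less[of "0::real"]
  proof eventually_elim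
    case (elim \<epsilon>)
    obtain w where "A \<epsilon> u v w" using assms(4) u(1) v(1) elim(2) unfolding fl_algorithm_def by blast
    then have "lp_norm p (w - \<beta> u v) \<le> F * lp_norm q u * lp_norm q v * \<epsilon> + C * \<epsilon>\<^sup>2"
      using elim u v by simp
    then have "0 \<le> F * lp_norm q u * lp_norm q v * \<epsilon> + C * \<epsilon>\<^sup>2"
      using lp_norm_nonneg order_trans by blast
    then have "0 \<le> (F * U + C * \<epsilon>) * \<epsilon>" by (simp add: U_def algebra_simps power2_eq_square)
    then show ?case using elim by (simp add: zero_le_mult_iff)
  qed
  moreover have "((\<lambda>\<epsilon>. - (C * \<epsilon>)) \<longlongrightarrow> - (C * 0)) (at_right 0)"
    by (intro tendsto_intros)
  ultimately have "- (C * 0) \<le> F * U"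
    by (intro tendsto_upperbound) auto
  then show ?thesis using \<open>0 < U\<close> by (simp add: zero_le_mult_iff)
qed

text \<open>If one of the inputs has dimension zero, then the factor multiplies \<open>\<parallel>u\<parallel>\<^sub>q \<parallel>v\<parallel>\<^sub>q = 0\<close> and can be exchanged at
  will.\<close>

lemma forward_error_bound_degenerate:
  assumes "1 \<le> q" "e = 0 \<or> f = 0" "forward_error_bound p q e f \<beta> A F"
  shows "forward_error_bound p q e f \<beta> A F'"
proof -
  have same: "F * lp_norm q u * lp_norm q v = F' * lp_norm q u * lp_norm q v"
    if "u \<in> carrier_vec e" "v \<in> carrier_vec f" for u v
    using lp_norm_empty[OF assms(1)] assms(2) that by auto
  show ?thesis
    unfolding forward_error_bound_def
  proof
    fix B
    obtain C where "\<forall>\<^sub>F \<epsilon> in at_right 0. \<forall>u\<in>carrier_vec e. \<forall>v\<in>carrier_vec f. \<forall>w.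
        lp_norm q u \<le> B \<longrightarrow> lp_norm q v \<le> B \<longrightarrow> A \<epsilon> u v w \<longrightarrow>
        lp_norm p (w - \<beta> u v) \<le> F * lp_norm q u * lp_norm q v * \<epsilon> + C * \<epsilon>\<^sup>2"
      using assms(3) unfolding forward_error_bound_def by blast
    then have "\<forall>\<^sub>F \<epsilon> in at_right 0. \<forall>u\<in>carrier_vec e. \<forall>v\<in>carrier_vec f. \<forall>w.
        lp_norm q u \<le> B \<longrightarrow> lp_norm q v \<le> B \<longrightarrow> A \<epsilon> u v w \<longrightarrow>
        lp_norm p (w - \<beta> u v) \<le> F' * lp_norm q u * lp_norm q v * \<epsilon> + C * \<epsilon>\<^sup>2"
      by (rule eventually_mono) (metis same)
    then show "\<exists>C. \<forall>\<^sub>F \<epsilon> in at_right 0. \<forall>u\<in>carrier_vec e. \<forall>v\<in>carrier_vec f. \<forall>w.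
        lp_norm q u \<le> B \<longrightarrow> lp_norm q v \<le> B \<longrightarrow> A \<epsilon> u v w \<longrightarrow>
        lp_norm p (w - \<beta> u v) \<le> F' * lp_norm q u * lp_norm q v * \<epsilon> + C * \<epsilon>\<^sup>2" ..
  qed
qed

lemma bilinear_map_degenerate:
  assumes "bilinear_map e f g b" "e = 0 \<or> f = 0" "1 \<le> p" "u \<in> carrier_vec e" "v \<in> carrier_vec f"
  shows "lp_norm p (b u v) = 0"
proof -
  have "0 \<cdot>\<^sub>v u = u \<or> 0 \<cdot>\<^sub>v v = v" using assms by (auto intro!: eq_vecI)
  moreover have "b (0 \<cdot>\<^sub>v u) v = 0 \<cdot>\<^sub>v b u v" "b u (0 \<cdot>\<^sub>v v) = 0 \<cdot>\<^sub>v b u v"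
    using assms by (simp_all add: bilinear_map_def)
  ultimately have "b u v = 0 \<cdot>\<^sub>v b u v" by metis
  moreover have "lp_norm p (0 \<cdot>\<^sub>v x) = 0" for x
    unfolding lp_norm_eq_lp_set using assms(3) by (intro lp_set_eq_0I) auto
  ultimately show ?thesis by metis
qed

theorem theorem18:
  fixes p q :: ereal
    and e f g r e0 f0 g0 l :: nat
    and L R P :: "real mat"
    and \<beta> \<beta>0 :: "real vec \<Rightarrow> real vec \<Rightarrow> real vec"
    and A0 :: fl_bilinear
    and F0 \<Gamma>0 \<Gamma> \<gamma> :: real
  assumes "1 \<le> p" and "1 \<le> q"
    and "L \<in> carrier_mat r e" and "R \<in> carrier_mat r f" and "P \<in> carrier_mat g r"
    and "represents L R P \<beta>"
    and "bilinear_map e0 f0 g0 \<beta>0"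
    and "fl_algorithm e0 f0 g0 A0"
    and "forward_error_bound p q e0 f0 \<beta>0 A0 F0"
    and "\<gamma> = growth_factor p q L R P" and "\<gamma> \<noteq> 0"
    and "amplification_factors p q L R P \<beta> e0 f0 g0 \<beta>0 \<Gamma>0 \<Gamma>"
  shows "forward_error_bound p q (e0 * e ^ l) (f0 * f ^ l)
           (bilin_pow L R P e0 f0 g0 \<beta>0 l)
           (fl_bilin_pow L R P e0 f0 g0 A0 l)
           (\<gamma> ^ l * (F0 + real (Q0 L R P) * \<Gamma>0 * (\<Sum>i<l. (\<Gamma> / \<gamma>) ^ i)))"
proof (cases "e0 = 0 \<or> f0 = 0")
  case True
  have norm: "lp_norm p (bilin_pow L R P e0 f0 g0 \<beta>0 l u v) \<le> 0 * 0 ^ l * lp_norm q u * lp_norm q v"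
    if "u \<in> carrier_vec (e0 * e ^ l)" "v \<in> carrier_vec (f0 * f ^ l)" for l u v
    using bilinear_map_degenerate[OF bilinear_map_bilin_pow[OF assms(3-5,7)] _ assms(1) that] True
    by auto
  have "forward_error_bound p q e0 f0 \<beta>0 A0 0"
    using forward_error_bound_degenerate[OF assms(2) True assms(9)] .
  from forward_error_bound_bilin_pow[OF assms(1-5,7,8) this assms(10,11) _ _ _ norm, of l]
  show ?thesis by (rule forward_error_bound_degenerate[OF assms(2), rotated]) (use True in auto)
next
  case False
  have dims: "dim_col L = e" "dim_col R = f" "dim_row P = g" using assms by auto
  have F0: "0 \<le> F0" using forward_error_factor_nonneg[OF assms(2) _ _ assms(8,9)] False by simp
  show ?thesis
  proof (cases "p \<in> {2, \<infinity>} \<and> q \<in> {2, \<infinity>} \<and> (\<exists>m k n. encodes_matmul m k n e f g \<beta>)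
      \<and> (\<exists>m0 k0 n0. encodes_matmul m0 k0 n0 e0 f0 g0 \<beta>0)")
    case matmul: True
    obtain m k n m0 k0 n0 where \<beta>: "encodes_matmul m k n e f g \<beta>" "\<Gamma> = matmul_factor p q m k n"
      and \<beta>0: "encodes_matmul m0 k0 n0 e0 f0 g0 \<beta>0" "\<Gamma>0 = matmul_factor p q m0 k0 n0"
      using assms(12) matmul unfolding amplification_factors_def dims by (simp only: if_True simp_thms) blast
    have nn: "0 \<le> matmul_factor p q m k n" for m k n
      using matmul_norm_nonneg matmul_norm_le_factor by (rule order_trans)
    show ?thesis
      unfolding \<beta>(2) \<beta>0(2)
      by (rule forward_error_bound_bilin_pow[OF assms(1-5,7-11) F0 nn nn])
        (use matmul bilin_pow_norm_matmul[OF _ _ assms(3-5,7,6) \<beta>(1) \<beta>0(1)] in blast)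
  next
    case generic: False
    then have \<Gamma>: "\<Gamma> = growth_factor p q L R P"
      and \<Gamma>0: "\<And>u v. u \<in> carrier_vec e0 \<Longrightarrow> v \<in> carrier_vec f0 \<Longrightarrow>
        lp_norm p (\<beta>0 u v) \<le> \<Gamma>0 * lp_norm q u * lp_norm q v"
      using assms(12) unfolding amplification_factors_def dims by (simp_all only: if_False simp_thms)
    obtain u v where uv: "u \<in> carrier_vec e0" "0 < lp_norm q u" "v \<in> carrier_vec f0" "0 < lp_norm q v"
      using lp_norm_pos[OF _ assms(2)] False by (metis gr0I)
    have "0 \<le> \<Gamma>0 * (lp_norm q u * lp_norm q v)"
      using order_trans[OF lp_norm_nonneg \<Gamma>0[OF uv(1,3)]] by (simp add: mult.assoc)
    then have nn: "0 \<le> \<Gamma>0" using uv mult_pos_pos[OF uv(2,4)] by (simp add: zero_le_mult_iff)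
    have "0 \<le> \<Gamma>" by (simp add: \<Gamma> growth_factor_def)
    then show ?thesis
      by (rule forward_error_bound_bilin_pow[OF assms(1-5,7-11) F0 nn])
        (use bilin_pow_norm_growth[OF assms(1-5,7) nn \<Gamma>0] in \<open>simp add: \<Gamma>\<close>)
  qed
qed

end
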